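(* Let $n\ge 1$ and let $D=D_h\#\cdots\#D_h$ be a connected sum of $n$ copies of the Hopf link diagram $D_h$. Then the Khovanov homology $H_{*,*}(D)$ is a free abelian group, and its generating polynomial $h(a,b)(D)=\sum_{i,j}\operatorname{rank}(H_{i,j}(D))\,b^ia^j$ is $$h(a,b)(D)=(a^2+a^{-2})(a^4b^2+a^{-4}b^{-2})^n.$$
   Context: Khovanov homology (framed unoriented version). A link diagram $D$ is a diagram on the disc of an unoriented framed link in the 3-ball. A Kauffman state $s$ of $D$ assigns to each crossing a marker $+1$ or $-1$. The smoothing of a crossing given by a positive marker joins the two regions swept out when the over-strand is rotated counterclockwise towards the under-strand (Kauffman's $A$-smoothing); a negative marker gives the other smoothing. $D_s$ is the system of circles obtained by smoothing all crossings according to $s$, and $\sigma(s)$ is the number of positive markers minus the number of negative markers. An enhanced state $S$ is a Kauffman state $s$ with a sign $+$ or $-$ assigned to each circle of $D_s$; $D_S=D_s$, $\sigma(S)=\sigma(s)$, and $\tau(S)$ is the number of positive circles minus the number of negative circles. $\mathcal{C}_{i,j}(D)$ is the free abelian group on the enhanced states $S$ with $\sigma(S)=i$ and $\sigma(S)+2\tau(S)=j$. After ordering the crossings, $d_{i,j}:\mathcal{C}_{i,j}(D)\to\mathcal{C}_{i-2,j}(D)$ is $d(S)=\sum_{S'}(-1)^{t(S:S')}[S:S']S'$, summed over enhanced states $S'$ generating $\mathcal{C}_{i-2,j}(D)$, where $[S:S']=1$ if the markers of $S$ and $S'$ differ at exactly one crossing $c$ and all circles of $D_S$ and $D_{S'}$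 not touching $c$ have the same signs in $S$ and $S'$, and $[S:S']=0$ otherwise; $t(S:S')$ is the number of negative markers of $S$ at crossings bigger than $c$. $H_{i,j}(D)=\ker(d_{i,j})/d_{i+2,j}(\mathcal{C}_{i+2,j}(D))$. $D_h$ is the standard 2-crossing diagram of the Hopf link. For a diagram $D'$, $D'\#D_h$ is obtained by choosing a non-crossing point of $D'$ and adding a new small circle component meeting a short arc of $D'$ around this point in exactly two crossings, passing over the arc at one and under it at the other. A connected sum of $n$ copies of $D_h$ is obtained by iterating this operation $n$ times starting from the crossingless diagram of the trivial knot. *)

theory Defs
  imports
    "HOL-Algebra.Free_Abelian_Groups"
    "HOL-Library.Groups_Big_Fun"
    "HOL-Library.Product_Plus"
begin

text \<open>
  Diagrams are given by planar diagram codes. \<open>edges\<close> is the set of edges of the diagram, i.e. of the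
  arcs between consecutive crossing passages together with the closed components without crossings.
  For a crossing \<open>c\<close>, \<open>ends D c\<close> lists the four edges arriving at \<open>c\<close> in counterclockwise order,
  beginning with an end of the under-strand: positions 0 and 2 are the under-strand, 1 and 3 the
  over-strand. An edge occupies two positions in total, or none if it is a crossingless component.
  There is no orientation, so \<open>[e0, e1, e2, e3]\<close> and \<open>[e2, e3, e0, e1]\<close> describe the same crossing.
  The linear order on the type of crossings is the ordering of the crossings used for the signs of
  the differential; as the crossings of a diagram may be named by arbitrary elements of
  that type, every ordering occurs.
\<close>

record ('c, 'e) diagram =
  crossings :: "'c set"
  edges :: "'e set"
  ends :: "'c \<Rightarrow> 'e list"


section \<open>Connected sums with the Hopf link diagram\<close>

definition trivial_knot :: "('c, 'e) diagram \<Rightarrow> bool" where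
  "trivial_knot D \<longleftrightarrow> crossings D = {} \<and> (\<exists>e. edges D = {e})"

text \<open>
  The new circle runs around a point of the edge \<open>e\<close>. It passes over \<open>e\<close> at \<open>x\<close> and under it at \<open>y\<close>.
  Direct the part \<open>m\<close> of \<open>e\<close> inside the circle from \<open>x\<close> to \<open>y\<close>, say northwards; \<open>f\<close> is then the western
  and \<open>g\<close> the eastern half of the circle. The code at \<open>x\<close> (under-strand \<open>e\<close>, \<open>m\<close>) starts in the
  south, the code at \<open>y\<close> (under-strand \<open>g\<close>, \<open>f\<close>) starts in the east.

  In the first rule \<open>e\<close> is a crossingless component, whose part outside the circle keeps the name
  \<open>e\<close>. In the second rule \<open>e\<close> is cut into \<open>e\<close>, \<open>m\<close>, \<open>e'\<close>, where \<open>e'\<close> is the piece that leads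
  from \<open>y\<close> to the \<open>k\<close>-th position at \<open>c\<close>. Both occurrences of \<open>e\<close> are allowed here, which accounts
  for the two ways of placing the circle (over-passage first or under-passage first).
\<close>

inductive connect_hopf :: "('c, 'e) diagram \<Rightarrow> ('c, 'e) diagram \<Rightarrow> bool" where
  on_loop:
  "\<lbrakk>e \<in> edges D; \<forall>c\<in>crossings D. e \<notin> set (ends D c);
    distinct [x, y]; {x, y} \<inter> crossings D = {};
    distinct [m, f, g]; {m, f, g} \<inter> edges D = {}\<rbrakk>
   \<Longrightarrow> connect_hopf D
        \<lparr>crossings = crossings D \<union> {x, y},
         edges = edges D \<union> {m, f, g},
         ends = (ends D)(x := [e, g, m, f], y := [g, e, f, m])\<rparr>"
| on_arc:
  "\<lbrakk>e \<in> edges D; c \<in> crossings D; k < 4; ends D c ! k = e;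
    distinct [x, y]; {x, y} \<inter> crossings D = {};
    distinct [e', m, f, g]; {e', m, f, g} \<inter> edges D = {}\<rbrakk>
   \<Longrightarrow> connect_hopf D
        \<lparr>crossings = crossings D \<union> {x, y},
         edges = edges D \<union> {e', m, f, g},
         ends = (ends D)(c := (ends D c)[k := e'],
                         x := [e, g, m, f], y := [g, e', f, m])\<rparr>"

definition hopf_connected_sum :: "nat \<Rightarrow> ('c, 'e) diagram \<Rightarrow> bool" where
  "hopf_connected_sum n D \<longleftrightarrow> (\<exists>U. trivial_knot U \<and> (connect_hopf ^^ n) U D)"


section \<open>Enhanced Kauffman states\<close>

text \<open>
  A Kauffman state is represented by the set \<open>s\<close> of crossings carrying the marker \<open>+1\<close>.
  Rotating the over-strand (positions 1, 3) counterclockwise sweeps the region between positions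
  1 and 2 and the one between 3 and 0. Joining these regions connects position 0 with 1 and 2 with 3.
\<close>

definition smoothing_arcs :: "('c, 'e) diagram \<Rightarrow> 'c set \<Rightarrow> ('e \<times> 'e) set" where
  "smoothing_arcs D s =
     (\<Union>c\<in>crossings D.
        if c \<in> s then {(ends D c ! 0, ends D c ! 1), (ends D c ! 2, ends D c ! 3)}
        else {(ends D c ! 1, ends D c ! 2), (ends D c ! 3, ends D c ! 0)})"

text \<open>A circle of the smoothed diagram is represented by the set of edges it runs through.\<close>

definition circles :: "('c, 'e) diagram \<Rightarrow> 'c set \<Rightarrow> 'e set set" where
  "circles D s =
     edges D // {(e, e'). e \<in> edges D \<and> e' \<in> edges D \<and>
                          (e, e') \<in> (smoothing_arcs D s \<union> (smoothing_arcs D s)\<inverse>)\<^sup>*}"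

text \<open>An enhanced state is a Kauffman state together with the set of its positive circles.\<close>

type_synonym ('c, 'e) enhanced_state = "'c set \<times> 'e set set"

definition enhanced_states :: "('c, 'e) diagram \<Rightarrow> ('c, 'e) enhanced_state set" where
  "enhanced_states D = {(s, p). s \<subseteq> crossings D \<and> p \<subseteq> circles D s}"

definition sigma :: "('c, 'e) diagram \<Rightarrow> ('c, 'e) enhanced_state \<Rightarrow> int" where
  "sigma D S = int (card (fst S)) - int (card (crossings D - fst S))"

definition tau :: "('c, 'e) diagram \<Rightarrow> ('c, 'e) enhanced_state \<Rightarrow> int" where
  "tau D S = int (card (snd S)) - int (card (circles D (fst S) - snd S))"

definition generators :: "('c, 'e) diagram \<Rightarrow> int \<Rightarrow> int \<Rightarrow> ('c, 'e) enhanced_state set" where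
  "generators D i j = {S \<in> enhanced_states D. sigma D S = i \<and> sigma D S + 2 * tau D S = j}"


section \<open>Khovanov homology\<close>

definition differing :: "('c, 'e) enhanced_state \<Rightarrow> ('c, 'e) enhanced_state \<Rightarrow> 'c set" where
  "differing S S' = (fst S - fst S') \<union> (fst S' - fst S)"

definition incidence ::
  "('c, 'e) diagram \<Rightarrow> ('c, 'e) enhanced_state \<Rightarrow> ('c, 'e) enhanced_state \<Rightarrow> int" where
  "incidence D S S' =
     (if \<exists>c. differing S S' = {c} \<and>
             (\<forall>\<gamma> \<in> circles D (fst S) \<union> circles D (fst S').
                \<gamma> \<inter> set (ends D c) = {} \<longrightarrow> (\<gamma> \<in> snd S \<longleftrightarrow> \<gamma> \<in> snd S'))
      then 1 else 0)"

text \<open>Only used when \<open>S\<close> and \<open>S'\<close> differ at exactly one crossing, namely \<open>the_elem (differing S S')\<close>.\<close>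

definition sign_exponent ::
  "('c::linorder, 'e) diagram \<Rightarrow> ('c, 'e) enhanced_state \<Rightarrow> ('c, 'e) enhanced_state \<Rightarrow> nat" where
  "sign_exponent D S S' = card {c \<in> crossings D - fst S. the_elem (differing S S') < c}"

definition chain_group ::
  "('c, 'e) diagram \<Rightarrow> int \<Rightarrow> int \<Rightarrow> (('c, 'e) enhanced_state \<Rightarrow>\<^sub>0 int) monoid" where
  "chain_group D i j = free_Abelian_group (generators D i j)"

definition differential ::
  "('c::linorder, 'e) diagram \<Rightarrow> int \<Rightarrow> int \<Rightarrow>
     (('c, 'e) enhanced_state \<Rightarrow>\<^sub>0 int) \<Rightarrow> (('c, 'e) enhanced_state \<Rightarrow>\<^sub>0 int)" where
  "differential D i j =
     frag_extend (\<lambda>S. \<Sum>S'\<in>generators D (i - 2) j.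
       frag_cmul ((-1) ^ sign_exponent D S S' * incidence D S S') (frag_of S'))"

definition cycle_group ::
  "('c::linorder, 'e) diagram \<Rightarrow> int \<Rightarrow> int \<Rightarrow> (('c, 'e) enhanced_state \<Rightarrow>\<^sub>0 int) monoid" where
  "cycle_group D i j =
     (chain_group D i j)
       \<lparr>carrier := kernel (chain_group D i j) (chain_group D (i - 2) j) (differential D i j)\<rparr>"

definition khovanov_homology ::
  "('c::linorder, 'e) diagram \<Rightarrow> int \<Rightarrow> int \<Rightarrow> (('c, 'e) enhanced_state \<Rightarrow>\<^sub>0 int) set monoid" where
  "khovanov_homology D i j =
     cycle_group D i j Mod (differential D (i + 2) j ` carrier (chain_group D (i + 2) j))"


section \<open>Generating polynomial\<close>

definition free_abelian :: "('a, 'm) monoid_scheme \<Rightarrow> bool" where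
  "free_abelian G \<longleftrightarrow> (\<exists>B :: 'a set. G \<cong> free_Abelian_group B)"

text \<open>The rank of a finitely generated free abelian group.\<close>

definition free_rank :: "('a, 'm) monoid_scheme \<Rightarrow> nat" where
  "free_rank G = (THE r. G \<cong> free_Abelian_group {..<r})"

text \<open>
  Laurent polynomials in \<open>b\<close> and \<open>a\<close> with integer coefficients form the group ring of
  \<open>int \<times> int\<close>; \<open>mono_ba i j\<close> is \<open>b\<^sup>i a\<^sup>j\<close>.
\<close>

type_synonym laurent_ba = "int \<times> int \<Rightarrow>\<^sub>0 int"

definition mono_ba :: "int \<Rightarrow> int \<Rightarrow> laurent_ba" where
  "mono_ba i j = Poly_Mapping.single (i, j) 1"

definition khovanov_polynomial :: "('c::linorder, 'e) diagram \<Rightarrow> laurent_ba" where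
  "khovanov_polynomial D =
     Sum_any (\<lambda>(i, j). of_nat (free_rank (khovanov_homology D i j)) * mono_ba i j)"

end

theory Submission
  imports Defs "HOL.Modules"
begin

text \<open>
  Adding a Hopf circle to a diagram \<open>D\<close> at an edge \<open>e\<close> replaces the Khovanov complex \<open>C(D)\<close> by two
  shifted copies of it, up to homotopy. A single circle contributes a tensor factor \<open>V\<close>, the
  rank two Frobenius algebra in which a negative circle is the unit \<open>1\<close> and a positive circle is the
  element \<open>X\<close> with \<open>X\<^sup>2 = 0\<close>; the comultiplication is \<open>1 \<mapsto> 1 \<otimes> X + X \<otimes> 1\<close>, \<open>X \<mapsto> X \<otimes> X\<close>. The algebra \<open>V\<close>
  acts on \<open>C(D)\<close> through the circle that contains \<open>e\<close>, and this action commutes with the differential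
  (\<open>edge_action_boundary\<close>). The four ways of smoothing the two new crossings \<open>x\<close>, \<open>y\<close> split \<open>C(D')\<close>
  into blocks: with equal markers a separate small circle appears and the block is \<open>C(D) \<otimes> V\<close>, with
  different markers the block is \<open>C(D)\<close> (\<open>circles'\<close>). After a change of signs of the generators the
  differential of \<open>D'\<close> is the one of the total complex of the square

  \<open>C(D) \<otimes> V \<longrightarrow> C(D) \<oplus> C(D) \<longrightarrow> C(D) \<otimes> V\<close>,

  whose first map is two copies of multiplication and whose second map is the difference of two copies of
  comultiplication. Writing an element of the first term as \<open>a\<^sub>1 \<otimes> X + a\<^sub>2 \<otimes> 1\<close>, multiplication is
  \<open>X a\<^sub>1 + a\<^sub>2\<close>. It is split surjective with kernel \<open>{(a, - X a)}\<close>, a copy of \<open>C(D)\<close>; comultiplication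
  is split injective and its cokernel is another copy of \<open>C(D)\<close>; the rest of the square is
  contractible, by an explicit homotopy (\<open>homotopy_formula\<close>). The two copies of \<open>C(D)\<close> are shifted
  by \<open>(2, 4)\<close> and \<open>(-2, -4)\<close>, which is the factor \<open>a\<^sup>4b\<^sup>2 + a\<^sup>-\<^sup>4b\<^sup>-\<^sup>2\<close>.

  Starting from the trivial knot, whose complex is \<open>V\<close> with zero differential, \<open>n\<close> such steps
  contract the complex to the free group on \<open>2 ^ (n + 1)\<close> generators with zero differential
  (\<open>contraction\<close>, \<open>contraction_step\<close>). Hence the homology is free on these generators
  (\<open>homology_iso\<close>), and counting their degrees gives the polynomial.
\<close>

section \<open>Circles of smoothed diagrams\<close>

definition well_formed :: "('c, 'e) diagram \<Rightarrow> bool" where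
  "well_formed D \<longleftrightarrow> finite (crossings D) \<and> finite (edges D) \<and>
     (\<forall>c\<in>crossings D. length (ends D c) = 4 \<and> set (ends D c) \<subseteq> edges D)"

definition arcs_at :: "('c, 'e) diagram \<Rightarrow> 'c set \<Rightarrow> 'c \<Rightarrow> ('e \<times> 'e) set" where
  "arcs_at D s c = (if c \<in> s then {(ends D c ! 0, ends D c ! 1), (ends D c ! 2, ends D c ! 3)}
        else {(ends D c ! 1, ends D c ! 2), (ends D c ! 3, ends D c ! 0)})"

lemma smoothing_arcs_eq: "smoothing_arcs D s = (\<Union>c\<in>crossings D. arcs_at D s c)"
  by (simp add: smoothing_arcs_def arcs_at_def)

definition connection :: "('c, 'e) diagram \<Rightarrow> 'c set \<Rightarrow> ('e \<times> 'e) set" where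
  "connection D s = (smoothing_arcs D s \<union> (smoothing_arcs D s)\<inverse>)\<^sup>*"

definition circle_through :: "('c, 'e) diagram \<Rightarrow> 'c set \<Rightarrow> 'e \<Rightarrow> 'e set" where
  "circle_through D s u = {v \<in> edges D. (u, v) \<in> connection D s}"

lemma circles_eq: "circles D s = circle_through D s ` edges D"
  by (auto simp: circles_def quotient_def circle_through_def connection_def)

lemma connection_refl [simp]: "(u, u) \<in> connection D s"
  by (simp add: connection_def)

lemma connection_sym: "(u, v) \<in> connection D s \<Longrightarrow> (v, u) \<in> connection D s"
proof -
  have "sym (connection D s)"
    unfolding connection_def by (rule sym_rtrancl) (simp add: sym_Un_converse)
  then show "(u, v) \<in> connection D s \<Longrightarrow> (v, u) \<in> connection D s"
    by (meson symD)
qed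

lemma connection_trans:
  "(u, v) \<in> connection D s \<Longrightarrow> (v, w) \<in> connection D s \<Longrightarrow> (u, w) \<in> connection D s"
  by (simp add: connection_def)

lemma arc_connection: "(u, v) \<in> smoothing_arcs D s \<Longrightarrow> (u, v) \<in> connection D s"
  by (auto simp: connection_def)

lemma connection_induct [consumes 1, case_names refl arc]:
  assumes "(u, v) \<in> connection D s"
    and "P u"
    and "\<And>v w. (u, v) \<in> connection D s \<Longrightarrow> P v \<Longrightarrow>
           (v, w) \<in> smoothing_arcs D s \<or> (w, v) \<in> smoothing_arcs D s \<Longrightarrow> P w"
  shows "P v"
  using assms(1) unfolding connection_def
  by (induction rule: rtrancl_induct) (use assms(2,3) in \<open>auto simp: connection_def\<close>)

lemma in_circle_through [simp]: "u \<in> edges D \<Longrightarrow> u \<in> circle_through D s u"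
  by (simp add: circle_through_def)

lemma circle_through_in_circles: "u \<in> edges D \<Longrightarrow> circle_through D s u \<in> circles D s"
  by (simp add: circles_eq)

lemma circle_subset: "\<gamma> \<in> circles D s \<Longrightarrow> \<gamma> \<subseteq> edges D"
  by (auto simp: circles_eq circle_through_def)

lemma circle_through_eq:
  assumes "\<gamma> \<in> circles D s" "u \<in> \<gamma>"
  shows "\<gamma> = circle_through D s u"
proof -
  obtain v where v: "v \<in> edges D" "\<gamma> = circle_through D s v"
    using assms(1) by (auto simp: circles_eq)
  have "(v, u) \<in> connection D s"
    using assms(2) v by (simp add: circle_through_def)
  then have "(v, w) \<in> connection D s \<longleftrightarrow> (u, w) \<in> connection D s" for w
    by (meson connection_sym connection_trans)
  then show ?thesis
    by (auto simp: v circle_through_def)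
qed

lemma circle_nonempty: "\<gamma> \<in> circles D s \<Longrightarrow> \<gamma> \<noteq> {}"
  by (auto simp: circles_eq circle_through_def intro: connection_refl)

lemma circle_through_eq_iff:
  assumes "u \<in> edges D" "v \<in> edges D"
  shows "circle_through D s u = circle_through D s v \<longleftrightarrow> (u, v) \<in> connection D s"
  using assms circle_through_eq[OF circle_through_in_circles[OF assms(1)], of v s]
  by (metis (mono_tags, lifting) circle_through_def in_circle_through mem_Collect_eq)

lemma finite_circles: "finite (edges D) \<Longrightarrow> finite (circles D s)"
  by (simp add: circles_eq)

text \<open>A circle that avoids a crossing does not notice how this crossing is smoothed.\<close>

lemma circle_off_crossing:
  assumes "\<gamma> \<in> circles D s" "\<gamma> \<inter> set (ends D c) = {}" "s - {c} = s' - {c}"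
    and wf: "well_formed D"
  shows "\<gamma> \<in> circles D s'"
proof -
  obtain u where u: "u \<in> edges D" "\<gamma> = circle_through D s u"
    using assms(1) by (auto simp: circles_eq)
  have same_arcs: "(v, w) \<in> smoothing_arcs D s \<longleftrightarrow> (v, w) \<in> smoothing_arcs D s'"
    if "v \<in> \<gamma> \<or> w \<in> \<gamma>" for v w
  proof -
    have "(v, w) \<in> arcs_at D s c' \<longleftrightarrow> (v, w) \<in> arcs_at D s' c'" if "c' \<in> crossings D" for c'
    proof (cases "c' = c")
      case True
      with \<open>c' \<in> crossings D\<close> wf have "length (ends D c) = 4"
        by (simp add: well_formed_def)
      then have "arcs_at D s c \<subseteq> set (ends D c) \<times> set (ends D c)"
        "arcs_at D s' c \<subseteq> set (ends D c) \<times> set (ends D c)"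
        by (auto simp: arcs_at_def)
      with True assms(2) \<open>v \<in> \<gamma> \<or> w \<in> \<gamma>\<close> show ?thesis by blast
    next
      case False
      then have "c' \<in> s \<longleftrightarrow> c' \<in> s'" using assms(3) by blast
      then show ?thesis by (simp add: arcs_at_def)
    qed
    then show ?thesis by (auto simp: smoothing_arcs_eq)
  qed
  have inside: "w \<in> \<gamma>" if "v \<in> \<gamma>" "(v, w) \<in> smoothing_arcs D s \<or> (w, v) \<in> smoothing_arcs D s" for v w
  proof -
    have "w \<in> edges D"
      using that(2) wf by (fastforce simp: smoothing_arcs_def well_formed_def split: if_splits)
    moreover have "(v, w) \<in> connection D s"
      using that(2) by (meson arc_connection connection_sym)
    ultimately show ?thesis
      using that(1) u by (auto simp: circle_through_def intro: connection_trans)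
  qed
  have "u \<in> \<gamma>" using u by simp
  \<comment> \<open>A path that starts in \<open>\<gamma>\<close> never leaves it, and there the two smoothings have the same arcs.\<close>
  have "v \<in> \<gamma> \<and> (u, v) \<in> connection D s'" if "(u, v) \<in> connection D s" for v
    using that
  proof (induction rule: connection_induct)
    case refl
    then show ?case using \<open>u \<in> \<gamma>\<close> by simp
  next
    case (arc v w)
    then show ?case using inside same_arcs
      by (meson arc_connection connection_sym connection_trans)
  qed
  moreover have "v \<in> \<gamma>" if "(u, v) \<in> connection D s'" for v
    using that
  proof (induction rule: connection_induct)
    case refl
    then show ?case by fact
  next
    case (arc v w)
    then show ?case using inside same_arcs by meson
  qed
  ultimately have "\<gamma> = circle_through D s' u"
    using circle_subset[OF assms(1)] u(2) unfolding circle_through_def by blast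
  then show ?thesis using u by (simp add: circle_through_in_circles)
qed

text \<open>Whichever way a crossing is smoothed, its four ends are joined in pairs, which leaves at
  most two circles there.\<close>

lemma card_circles_at_crossing:
  assumes "c \<in> crossings D" "well_formed D"
  shows "card {\<gamma> \<in> circles D s. \<gamma> \<inter> set (ends D c) \<noteq> {}} \<le> 2"
proof -
  obtain e0 e1 e2 e3 where ends: "ends D c = [e0, e1, e2, e3]"
    using assms by (auto simp: well_formed_def length_Suc_conv numeral_eq_Suc)
  have ed: "{e0, e1, e2, e3} \<subseteq> edges D"
    using assms ends by (fastforce simp: well_formed_def)
  obtain u v where uv: "{circle_through D s e0, circle_through D s e1, circle_through D s e2,
      circle_through D s e3} \<subseteq> {u, v}"
  proof (cases "c \<in> s")
    case True
    have "arcs_at D s c \<subseteq> connection D s"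
      using assms(1) by (auto simp: smoothing_arcs_eq intro!: arc_connection)
    then have "{(e0, e1), (e2, e3)} \<subseteq> connection D s"
      using True ends by (simp add: arcs_at_def)
    then have "circle_through D s e0 = circle_through D s e1"
      "circle_through D s e2 = circle_through D s e3"
      using ed by (simp_all add: circle_through_eq_iff)
    then show ?thesis using that[of "circle_through D s e0" "circle_through D s e2"] by simp
  next
    case False
    have "arcs_at D s c \<subseteq> connection D s"
      using assms(1) by (auto simp: smoothing_arcs_eq intro!: arc_connection)
    then have "{(e1, e2), (e3, e0)} \<subseteq> connection D s"
      using False ends by (simp add: arcs_at_def)
    then have "circle_through D s e1 = circle_through D s e2"
      "circle_through D s e3 = circle_through D s e0"
      using ed by (simp_all add: circle_through_eq_iff)
    then show ?thesis using that[of "circle_through D s e0" "circle_through D s e2"] by simp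
  qed
  have "{\<gamma> \<in> circles D s. \<gamma> \<inter> set (ends D c) \<noteq> {}} \<subseteq> {u, v}"
  proof
    fix \<gamma> assume "\<gamma> \<in> {\<gamma> \<in> circles D s. \<gamma> \<inter> set (ends D c) \<noteq> {}}"
    then obtain w where "w \<in> {e0, e1, e2, e3}" "\<gamma> = circle_through D s w"
      using circle_through_eq ends by fastforce
    then show "\<gamma> \<in> {u, v}" using uv by auto
  qed
  then have "card {\<gamma> \<in> circles D s. \<gamma> \<inter> set (ends D c) \<noteq> {}} \<le> card {u, v}"
    by (intro card_mono) auto
  also have "\<dots> \<le> 2" by (simp add: card_insert_if)
  finally show ?thesis .
qed

section \<open>The differential, crossing by crossing\<close>

text \<open>
  The sign choices \<open>q\<close> for which the state \<open>(s - {c}, q)\<close> occurs in the differential of \<open>(s, p)\<close>. Passing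
  from \<open>c\<close> positive to \<open>c\<close> negative lowers \<open>sigma\<close> by two, so keeping \<open>j\<close> means raising \<open>tau\<close> by one.
\<close>

definition transitions :: "('c, 'e) diagram \<Rightarrow> 'c set \<Rightarrow> 'e set set \<Rightarrow> 'c \<Rightarrow> 'e set set set" where
  "transitions D s p c =
     {q. q \<subseteq> circles D (s - {c}) \<and> tau D (s - {c}, q) = tau D (s, p) + 1 \<and>
         (\<forall>\<gamma> \<in> circles D s \<union> circles D (s - {c}).
            \<gamma> \<inter> set (ends D c) = {} \<longrightarrow> (\<gamma> \<in> p \<longleftrightarrow> \<gamma> \<in> q))}"

definition negatives_above :: "('c::linorder, 'e) diagram \<Rightarrow> 'c set \<Rightarrow> 'c \<Rightarrow> nat" where
  "negatives_above D s c = card {c' \<in> crossings D - s. c < c'}"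

definition boundary_at ::
  "('c, 'e) diagram \<Rightarrow> ('c, 'e) enhanced_state \<Rightarrow> 'c \<Rightarrow> ('c, 'e) enhanced_state \<Rightarrow>\<^sub>0 int" where
  "boundary_at D S c = (\<Sum>q\<in>transitions D (fst S) (snd S) c. frag_of (fst S - {c}, q))"

text \<open>
  All bidegrees at once: on the chains of degree \<open>(i, j)\<close> this is the differential of that degree
  (\<open>differential_eq_boundary\<close>). An ungraded map avoids carrying the indices through all
  computations; the degrees are tracked separately.
\<close>

definition boundary ::
  "('c::linorder, 'e) diagram \<Rightarrow> (('c, 'e) enhanced_state \<Rightarrow>\<^sub>0 int) \<Rightarrow>
     (('c, 'e) enhanced_state \<Rightarrow>\<^sub>0 int)" where
  "boundary D = frag_extend (\<lambda>S. \<Sum>c\<in>fst S.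
     frag_cmul ((-1) ^ negatives_above D (fst S) c) (boundary_at D S c))"

lemma tau_eq:
  assumes "finite (edges D)" "p \<subseteq> circles D s"
  shows "tau D (s, p) = 2 * int (card p) - int (card (circles D s))"
proof -
  have "finite (circles D s)" using assms finite_circles by blast
  then have "card (circles D s - p) = card (circles D s) - card p" "card p \<le> card (circles D s)"
    using assms(2) finite_subset by (simp_all add: card_Diff_subset[OF finite_subset] card_mono)
  then show ?thesis by (simp add: tau_def)
qed

lemma sigma_eq:
  assumes "finite (crossings D)" "s \<subseteq> crossings D"
  shows "sigma D (s, p) = 2 * int (card s) - int (card (crossings D))"
proof -
  have "card (crossings D - s) = card (crossings D) - card s" "card s \<le> card (crossings D)"
    using assms by (simp_all add: card_Diff_subset[OF finite_subset] card_mono)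
  then show ?thesis by (simp add: sigma_def)
qed

lemma sigma_remove:
  assumes "finite (crossings D)" "s \<subseteq> crossings D" "c \<in> s"
  shows "sigma D (s - {c}, q) = sigma D (s, p) - 2"
proof -
  have "finite s" using assms finite_subset by blast
  then have "card s = Suc (card (s - {c}))" using assms(3) by (rule card.remove)
  moreover have "s - {c} \<subseteq> crossings D" using assms(2) by blast
  ultimately show ?thesis using assms by (simp add: sigma_eq)
qed

lemma finite_transitions: "finite (edges D) \<Longrightarrow> finite (transitions D s p c)"
  by (rule finite_subset[of _ "Pow (circles D (s - {c}))"])
    (auto simp: transitions_def finite_circles)

abbreviation chains ::
  "('c, 'e) diagram \<Rightarrow> int \<Rightarrow> int \<Rightarrow> (('c, 'e) enhanced_state \<Rightarrow>\<^sub>0 int) set" where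
  "chains D i j \<equiv> carrier (chain_group D i j)"

lemma chains_iff [simp]: "a \<in> chains D i j \<longleftrightarrow> Poly_Mapping.keys a \<subseteq> generators D i j"
  by (simp add: chain_group_def)

lemma sym_diff_singleton:
  assumes "(s - t) \<union> (t - s) = {c}"
  shows "(c \<in> s \<and> t = s - {c}) \<or> (c \<in> t \<and> s = t - {c})"
proof -
  have *: "z \<noteq> c \<Longrightarrow> z \<in> s \<longleftrightarrow> z \<in> t" "(c \<in> s) \<noteq> (c \<in> t)" for z
    using assms by (blast, blast)
  have "t = s - {c}" if "c \<in> s"
  proof (rule Set.set_eqI)
    fix z show "z \<in> t \<longleftrightarrow> z \<in> s - {c}"
      using *(1)[of z] *(2) that by (cases "z = c") simp_all
  qed
  moreover have "s = t - {c}" if "c \<notin> s"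
  proof (rule Set.set_eqI)
    fix z show "z \<in> s \<longleftrightarrow> z \<in> t - {c}"
      using *(1)[of z] *(2) that by (cases "z = c") simp_all
  qed
  ultimately show ?thesis using *(2) by (cases "c \<in> s") simp_all
qed

lemma remove_inj: "c \<in> s \<Longrightarrow> c' \<in> s \<Longrightarrow> s - {c} = s - {c'} \<Longrightarrow> c = c'"
  using arg_cong[of "s - {c}" "s - {c'}" "\<lambda>A. c \<in> A"] by auto

lemma incidence_generators:
  assumes S: "S \<in> generators D i j" and wf: "well_formed D"
  shows "{S' \<in> generators D (i - 2) j. incidence D S S' \<noteq> 0}
         = (\<lambda>(c, q). (fst S - {c}, q)) ` (SIGMA c : fst S. transitions D (fst S) (snd S) c)"
    (is "?L = ?R")
proof -
  obtain s p where Seq: "S = (s, p)" by fastforce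
  have s: "s \<subseteq> crossings D" "p \<subseteq> circles D s" "sigma D (s, p) = i"
     "sigma D (s, p) + 2 * tau D (s, p) = j"
    using S by (auto simp: Seq generators_def enhanced_states_def)
  have fin: "finite (crossings D)" "finite (edges D)" using wf by (auto simp: well_formed_def)
  have "?L \<subseteq> ?R"
  proof
    fix S' assume S': "S' \<in> ?L"
    obtain s' q where S'eq: "S' = (s', q)" by fastforce
    have "\<exists>c. differing S S' = {c} \<and> (\<forall>\<gamma> \<in> circles D (fst S) \<union> circles D (fst S').
        \<gamma> \<inter> set (ends D c) = {} \<longrightarrow> (\<gamma> \<in> snd S \<longleftrightarrow> \<gamma> \<in> snd S'))"
    proof (rule ccontr)
      assume "\<not> ?thesis"
      then have "incidence D S S' = 0" unfolding incidence_def by (rule if_not_P)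
      with S' show False by simp
    qed
    then obtain c where c: "(s - s') \<union> (s' - s) = {c}"
      and off: "\<forall>\<gamma> \<in> circles D s \<union> circles D s'. \<gamma> \<inter> set (ends D c) = {} \<longrightarrow> (\<gamma> \<in> p \<longleftrightarrow> \<gamma> \<in> q)"
      unfolding Seq S'eq differing_def fst_conv snd_conv by blast
    have s': "s' \<subseteq> crossings D" "q \<subseteq> circles D s'" "sigma D (s', q) = i - 2"
     "sigma D (s', q) + 2 * tau D (s', q) = j"
      using S' by (auto simp: S'eq generators_def enhanced_states_def)
    have "c \<in> s \<and> s' = s - {c}"
    proof (rule ccontr)
      assume "\<not> (c \<in> s \<and> s' = s - {c})"
      then have "c \<in> s'" "s = s' - {c}" using sym_diff_singleton[OF c] by blast+
      then have "sigma D (s, p) = sigma D (s', q) - 2"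
        using sigma_remove[OF fin(1) s'(1)] by simp
      then show False using s(3) s'(3) by linarith
    qed
    then have "c \<in> s" "s' = s - {c}" by auto
    moreover have "q \<in> transitions D s p c"
      using off s' s unfolding transitions_def \<open>s' = s - {c}\<close> by simp
    ultimately show "S' \<in> ?R"
      unfolding Seq S'eq by (intro image_eqI[of _ _ "(c, q)"]) auto
  qed
  moreover have "?R \<subseteq> ?L"
  proof
    fix S' assume "S' \<in> ?R"
    then obtain c q where c: "c \<in> s" and q: "q \<in> transitions D s p c" and S'eq: "S' = (s - {c}, q)"
      by (auto simp: Seq)
    have "sigma D (s - {c}, q) = sigma D (s, p) - 2"
      using sigma_remove[OF fin(1) s(1) c] .
    then have "S' \<in> generators D (i - 2) j"
      using q s c by (auto simp: S'eq generators_def enhanced_states_def transitions_def)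
    moreover have "differing S S' = {c}" using c by (auto simp: Seq S'eq differing_def)
    then have "incidence D S S' \<noteq> 0"
      using q by (auto simp: incidence_def Seq S'eq transitions_def)
    ultimately show "S' \<in> ?L" by simp
  qed
  ultimately show ?thesis by blast
qed

lemma finite_generators: "well_formed D \<Longrightarrow> finite (generators D i j)"
proof -
  assume "well_formed D"
  then have "finite (crossings D)" "finite (edges D)" by (auto simp: well_formed_def)
  then have "finite (SIGMA s : Pow (crossings D). Pow (circles D s))"
    by (auto intro!: finite_SigmaI finite_circles)
  then show ?thesis
    by (rule rev_finite_subset) (auto simp: generators_def enhanced_states_def)
qed

lemma differential_eq_boundary:
  assumes a: "a \<in> chains D i j" and wf: "well_formed D"
  shows "differential D i j a = boundary D a"
  unfolding differential_def boundary_def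
proof (rule frag_extend_eq)
  fix S assume "S \<in> Poly_Mapping.keys a"
  then have S: "S \<in> generators D i j" using a by auto
  obtain s p where Seq: "S = (s, p)" by fastforce
  let ?g = "\<lambda>S'. frag_cmul ((-1) ^ sign_exponent D S S' * incidence D S S') (frag_of S')"
  let ?T = "SIGMA c : s. transitions D s p c"
  have fin: "finite s" "finite (edges D)"
    using wf S by (auto simp: well_formed_def generators_def enhanced_states_def Seq intro: finite_subset)
  have inj: "inj_on (\<lambda>(c, q). (s - {c}, q)) ?T"
    by (auto simp: inj_on_def dest: remove_inj)
  have "(\<Sum>S'\<in>generators D (i - 2) j. ?g S')
      = (\<Sum>S'\<in>{S' \<in> generators D (i - 2) j. incidence D S S' \<noteq> 0}. ?g S')"
    by (rule sum.mono_neutral_right) (auto simp: finite_generators wf)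
  also have "\<dots> = (\<Sum>S'\<in>(\<lambda>(c, q). (s - {c}, q)) ` ?T. ?g S')"
    using incidence_generators[OF S wf] by (simp add: Seq)
  also have "\<dots> = (\<Sum>(c, q)\<in>?T. ?g (s - {c}, q))"
    by (subst sum.reindex[OF inj]) (simp add: comp_def case_prod_unfold)
  also have "\<dots> = (\<Sum>(c, q)\<in>?T. frag_cmul ((-1) ^ negatives_above D s c) (frag_of (s - {c}, q)))"
  proof (rule sum.cong[OF refl], clarify)
    fix c q assume c: "c \<in> s" and q: "q \<in> transitions D s p c"
    have d: "differing S (s - {c}, q) = {c}" using c by (auto simp: Seq differing_def)
    then have "sign_exponent D S (s - {c}, q) = negatives_above D s c"
      by (simp add: sign_exponent_def negatives_above_def Seq)
    moreover have "incidence D S (s - {c}, q) = 1"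
      using q d by (auto simp: incidence_def Seq transitions_def)
    ultimately show "?g (s - {c}, q) = frag_cmul ((-1) ^ negatives_above D s c) (frag_of (s - {c}, q))"
      by simp
  qed
  also have "\<dots> = (\<Sum>c\<in>s. \<Sum>q\<in>transitions D s p c.
      frag_cmul ((-1) ^ negatives_above D s c) (frag_of (s - {c}, q)))"
    using fin by (simp add: sum.Sigma finite_transitions)
  also have "\<dots> = (\<Sum>c\<in>s. frag_cmul ((-1) ^ negatives_above D s c) (boundary_at D S c))"
    by (simp add: boundary_at_def Seq frag_cmul_sum)
  finally show "(\<Sum>S'\<in>generators D (i - 2) j. ?g S') =
      (\<Sum>c\<in>fst S. frag_cmul ((-1) ^ negatives_above D (fst S) c) (boundary_at D S c))"
    by (simp add: Seq)
qed

lemma boundary_chains: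
  assumes a: "a \<in> chains D i j" and wf: "well_formed D"
  shows "boundary D a \<in> chains D (i - 2) j"
proof -
  have "boundary D a = differential D i j a"
    using differential_eq_boundary[OF assms] by simp
  also have "Poly_Mapping.keys \<dots> \<subseteq> generators D (i - 2) j"
    unfolding differential_def
  proof (rule order_trans[OF keys_frag_extend], rule UN_least)
    fix S
    show "Poly_Mapping.keys (\<Sum>S'\<in>generators D (i - 2) j.
        frag_cmul ((-1) ^ sign_exponent D S S' * incidence D S S') (frag_of S'))
        \<subseteq> generators D (i - 2) j"
      by (rule order_trans[OF keys_sum], rule UN_least, rule order_trans[OF keys_cmul]) simp
  qed
  finally show ?thesis by simp
qed

section \<open>The action of an edge\<close>

text \<open>
  Multiplication by \<open>X\<close> at the circle through the edge \<open>u\<close>: it turns the unit, a negative circle, into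
  a positive one and sends a positive circle to \<open>X\<^sup>2 = 0\<close>.
\<close>

definition make_positive ::
  "('c, 'e) diagram \<Rightarrow> 'e \<Rightarrow> ('c, 'e) enhanced_state \<Rightarrow> ('c, 'e) enhanced_state \<Rightarrow>\<^sub>0 int" where
  "make_positive D u S = (if circle_through D (fst S) u \<in> snd S then 0
     else frag_of (fst S, insert (circle_through D (fst S) u) (snd S)))"

definition edge_action ::
  "('c, 'e) diagram \<Rightarrow> 'e \<Rightarrow> (('c, 'e) enhanced_state \<Rightarrow>\<^sub>0 int) \<Rightarrow>
     (('c, 'e) enhanced_state \<Rightarrow>\<^sub>0 int)" where
  "edge_action D u = frag_extend (make_positive D u)"

text \<open>
  Multiplication by \<open>X\<close> kills a state in which the chosen circle is already positive. This lemma says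
  that the differential respects this. At most two circles touch \<open>c\<close> before the change and at most two
  after it, while the condition on \<open>tau\<close> fixes the number of positive ones among them; if the circle of
  \<open>u\<close> were positive before and negative after the change, more than four circles would be required. The
  count does not depend on whether circles merge or split at \<open>c\<close>.
\<close>

lemma transition_keeps_positive:
  assumes wf: "well_formed D" and u: "u \<in> edges D" and s: "s \<subseteq> crossings D" "c \<in> s"
    and p: "p \<subseteq> circles D s" "circle_through D s u \<in> p"
    and q: "q \<in> transitions D s p c"
  shows "circle_through D (s - {c}) u \<in> q"
proof (rule ccontr)
  assume not_in: "circle_through D (s - {c}) u \<notin> q"
  let ?\<gamma> = "circle_through D s u" and ?\<gamma>' = "circle_through D (s - {c}) u"
  define N where "N = {\<gamma> \<in> circles D s. \<gamma> \<inter> set (ends D c) = {}}"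
  define A where "A = {\<gamma> \<in> circles D s. \<gamma> \<inter> set (ends D c) \<noteq> {}}"
  define B where "B = {\<gamma> \<in> circles D (s - {c}). \<gamma> \<inter> set (ends D c) \<noteq> {}}"
  have c: "c \<in> crossings D" using s by blast
  have fin: "finite (edges D)" using wf by (simp add: well_formed_def)
  have N': "N = {\<gamma> \<in> circles D (s - {c}). \<gamma> \<inter> set (ends D c) = {}}"
  proof -
    have "\<gamma> \<in> circles D s \<longleftrightarrow> \<gamma> \<in> circles D (s - {c})" if "\<gamma> \<inter> set (ends D c) = {}" for \<gamma>
      using circle_off_crossing[OF _ that Diff_idemp[symmetric] wf]
        circle_off_crossing[OF _ that Diff_idemp wf] by blast
    then show ?thesis unfolding N_def by blast
  qed
  have q': "q \<subseteq> circles D (s - {c})" "tau D (s - {c}, q) = tau D (s, p) + 1"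
    and off: "\<And>\<gamma>. \<gamma> \<in> N \<Longrightarrow> \<gamma> \<in> p \<longleftrightarrow> \<gamma> \<in> q"
    using q by (auto simp: transitions_def N_def)
  have finNAB: "finite N" "finite A" "finite B"
    using finite_circles[OF fin] by (auto simp: N_def A_def B_def)
  have \<gamma>A: "?\<gamma> \<in> A"
  proof (rule ccontr)
    assume "?\<gamma> \<notin> A"
    then have "?\<gamma> \<in> N" using u by (simp add: A_def N_def circle_through_in_circles)
    moreover from this have "?\<gamma> = ?\<gamma>'"
      using u N' circle_through_eq[of ?\<gamma> D "s - {c}" u] by auto
    ultimately show False using p(2) off not_in by metis
  qed
  have \<gamma>B: "?\<gamma>' \<in> B"
  proof (rule ccontr)
    assume "?\<gamma>' \<notin> B"
    then have "?\<gamma>' \<in> N" using u by (simp add: B_def N' circle_through_in_circles)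
    then have "?\<gamma> = ?\<gamma>'"
      using u circle_through_eq[of ?\<gamma>' D s u] by (auto simp: N_def)
    with \<open>?\<gamma>' \<in> N\<close> show False using \<gamma>A by (auto simp: A_def N_def)
  qed
  have "circles D s = N \<union> A" "N \<inter> A = {}" by (auto simp: N_def A_def)
  moreover have "circles D (s - {c}) = N \<union> B" "N \<inter> B = {}" by (auto simp: N' B_def)
  ultimately have splits: "circles D s = N \<union> A" "N \<inter> A = {}"
    "circles D (s - {c}) = N \<union> B" "N \<inter> B = {}" by simp_all
  have cards: "card (circles D s) = card N + card A" "card (circles D (s - {c})) = card N + card B"
    unfolding splits using finNAB splits by (simp_all add: card_Un_disjoint)
  have pq: "p = (p \<inter> N) \<union> (p \<inter> A)" "q = (p \<inter> N) \<union> (q \<inter> B)"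
    using p(1) q'(1) splits off by blast+
  have "card p = card (p \<inter> N) + card (p \<inter> A)"
    by (subst pq(1), rule card_Un_disjoint) (use finNAB splits in auto)
  moreover have "card q = card (p \<inter> N) + card (q \<inter> B)"
    by (subst pq(2), rule card_Un_disjoint) (use finNAB splits in auto)
  moreover have "2 * int (card q) - int (card (circles D (s - {c})))
      = 2 * int (card p) - int (card (circles D s)) + 1"
    using q' p(1) fin by (simp add: tau_eq)
  \<comment> \<open>The circles of \<open>N\<close> avoid \<open>c\<close> and cancel; \<open>A\<close> and \<open>B\<close> have at most two elements each.\<close>
  ultimately have "2 * int (card (q \<inter> B)) - int (card B) = 2 * int (card (p \<inter> A)) - int (card A) + 1"
    using cards by linarith
  moreover have "card A \<le> 2" "card B \<le> 2"
    using card_circles_at_crossing[OF c wf] by (simp_all add: A_def B_def)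
  moreover have "card (p \<inter> A) \<ge> 1"
    using \<gamma>A p(2) finNAB by (simp add: Suc_le_eq card_gt_0_iff) blast
  moreover have "card (q \<inter> B) < card B"
    using \<gamma>B not_in finNAB by (intro psubset_card_mono) auto
  ultimately show False by linarith
qed

lemma circle_through_off_crossing:
  assumes "well_formed D" "u \<in> edges D" "s - {c} = s' - {c}"
    and "circle_through D s u \<inter> set (ends D c) = {}"
  shows "circle_through D s' u = circle_through D s u"
  using circle_through_eq[OF circle_off_crossing[OF circle_through_in_circles assms(4,3,1)], of u]
    assms(2) by simp

text \<open>
  Making the circle through \<open>u\<close> positive raises \<open>tau\<close> by two both before and after the change of marker,
  so the condition on \<open>tau\<close> is preserved. That every transition on the left arises in this way is
  \<open>transition_keeps_positive\<close>.
\<close>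

lemma transitions_make_positive:
  assumes wf: "well_formed D" and u: "u \<in> edges D" and s: "s \<subseteq> crossings D" "c \<in> s"
    and p: "p \<subseteq> circles D s" "\<gamma> \<notin> p"
    and \<gamma>: "\<gamma> = circle_through D s u" and \<gamma>': "\<gamma>' = circle_through D (s - {c}) u"
  shows "transitions D s (insert \<gamma> p) c = insert \<gamma>' ` {q \<in> transitions D s p c. \<gamma>' \<notin> q}"
proof -
  have fin: "finite (edges D)" using wf by (simp add: well_formed_def)
  have mem: "\<gamma> \<in> circles D s" "\<gamma>' \<in> circles D (s - {c})"
    using u by (simp_all add: \<gamma> \<gamma>' circle_through_in_circles)
  have fin_p: "finite p" using p fin finite_circles finite_subset by metis
  have tau_p: "tau D (s, insert \<gamma> p) = tau D (s, p) + 2"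
    using fin fin_p p mem by (simp add: tau_eq)
  have tau_q: "tau D (s - {c}, insert \<gamma>' q) = tau D (s - {c}, q) + 2"
    if "q \<subseteq> circles D (s - {c})" "\<gamma>' \<notin> q" for q
  proof -
    have "finite q" using that fin finite_circles finite_subset by metis
    then show ?thesis using fin that mem by (simp add: tau_eq)
  qed
  have same: "\<delta> = \<gamma> \<longleftrightarrow> \<delta> = \<gamma>'" if "\<delta> \<inter> set (ends D c) = {}" for \<delta>
    using that circle_through_off_crossing[OF wf u, of s c "s - {c}"]
      circle_through_off_crossing[OF wf u, of "s - {c}" c s] by (auto simp: \<gamma> \<gamma>')
  show ?thesis
  proof (intro equalityI subsetI)
    fix r assume r: "r \<in> transitions D s (insert \<gamma> p) c"
    have "\<gamma>' \<in> r"
      using transition_keeps_positive[OF wf u s _ _ r] p(1) mem by (simp add: \<gamma> \<gamma>')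
    define q where "q = r - {\<gamma>'}"
    have rq: "r = insert \<gamma>' q" "\<gamma>' \<notin> q" using \<open>\<gamma>' \<in> r\<close> by (auto simp: q_def)
    have "q \<in> transitions D s p c"
      unfolding transitions_def
    proof (intro CollectI conjI ballI impI)
      show "q \<subseteq> circles D (s - {c})" using r by (auto simp: q_def transitions_def)
      then show "tau D (s - {c}, q) = tau D (s, p) + 1"
        using tau_q[of q] rq tau_p r by (simp add: transitions_def)
      fix \<delta> assume \<delta>: "\<delta> \<in> circles D s \<union> circles D (s - {c})" "\<delta> \<inter> set (ends D c) = {}"
      then have "\<delta> \<in> insert \<gamma> p \<longleftrightarrow> \<delta> \<in> insert \<gamma>' q"
        using r rq(1) by (simp add: transitions_def)
      then show "\<delta> \<in> p \<longleftrightarrow> \<delta> \<in> q" using same[OF \<delta>(2)] p(2) rq(2) by blast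
    qed
    then show "r \<in> insert \<gamma>' ` {q \<in> transitions D s p c. \<gamma>' \<notin> q}" using rq by blast
  next
    fix r assume "r \<in> insert \<gamma>' ` {q \<in> transitions D s p c. \<gamma>' \<notin> q}"
    then obtain q where q: "q \<in> transitions D s p c" "\<gamma>' \<notin> q" and r: "r = insert \<gamma>' q" by blast
    have "q \<subseteq> circles D (s - {c})" using q by (simp add: transitions_def)
    show "r \<in> transitions D s (insert \<gamma> p) c"
      unfolding transitions_def
    proof (intro CollectI conjI ballI impI)
      show "r \<subseteq> circles D (s - {c})" using q mem by (simp add: r transitions_def)
      show "tau D (s - {c}, r) = tau D (s, insert \<gamma> p) + 1"
        using tau_q[of q] q tau_p by (simp add: r transitions_def)
      fix \<delta> assume \<delta>: "\<delta> \<in> circles D s \<union> circles D (s - {c})" "\<delta> \<inter> set (ends D c) = {}"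
      then have "\<delta> \<in> p \<longleftrightarrow> \<delta> \<in> q" using q by (simp add: transitions_def)
      then show "\<delta> \<in> insert \<gamma> p \<longleftrightarrow> \<delta> \<in> r" using same[OF \<delta>(2)] by (auto simp: r)
    qed
  qed
qed

lemma edge_action_boundary_at:
  assumes wf: "well_formed D" and u: "u \<in> edges D" and s: "s \<subseteq> crossings D" "c \<in> s"
    and p: "p \<subseteq> circles D s"
  shows "edge_action D u (boundary_at D (s, p) c)
    = (if circle_through D s u \<in> p then 0
       else boundary_at D (s, insert (circle_through D s u) p) c)"
proof -
  let ?\<gamma> = "circle_through D s u" and ?\<gamma>' = "circle_through D (s - {c}) u"
  let ?T = "transitions D s p c"
  have fin: "finite ?T" using wf by (simp add: finite_transitions well_formed_def)
  have "edge_action D u (boundary_at D (s, p) c) = (\<Sum>q\<in>?T. make_positive D u (s - {c}, q))"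
    by (simp add: edge_action_def boundary_at_def frag_extend_sum[OF fin] comp_def)
  also have "\<dots> = (\<Sum>q\<in>{q \<in> ?T. ?\<gamma>' \<notin> q}. frag_of (s - {c}, insert ?\<gamma>' q))"
    by (rule sum.mono_neutral_cong_right) (auto simp: fin make_positive_def)
  also have "\<dots> = (\<Sum>r\<in>insert ?\<gamma>' ` {q \<in> ?T. ?\<gamma>' \<notin> q}. frag_of (s - {c}, r))"
    by (subst sum.reindex) (auto simp: inj_on_def comp_def dest: insert_ident)
  also have "\<dots> = (if ?\<gamma> \<in> p then 0 else boundary_at D (s, insert ?\<gamma> p) c)"
  proof (cases "?\<gamma> \<in> p")
    case True
    then have "{q \<in> ?T. ?\<gamma>' \<notin> q} = {}" 
      using transition_keeps_positive[OF wf u s p] by auto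
    then show ?thesis using True by (simp only: image_empty sum.empty if_True)
  next
    case False
    then show ?thesis
      using transitions_make_positive[OF wf u s p False refl refl] by (simp add: boundary_at_def)
  qed
  finally show ?thesis .
qed

text \<open>
  The differential is linear over the algebra \<open>V\<close> acting at \<open>u\<close>. The signs are the same on both sides
  because the action does not change any marker.
\<close>

lemma edge_action_boundary:
  assumes wf: "well_formed D" and u: "u \<in> edges D" and a: "Poly_Mapping.keys a \<subseteq> enhanced_states D"
  shows "edge_action D u (boundary D a) = boundary D (edge_action D u a)"
  using a
proof (induction a rule: frag_induction)
  case zero
  then show ?case by (simp add: boundary_def edge_action_def)
next
  case (one S)
  obtain s p where S: "S = (s, p)" by fastforce
  then have s: "s \<subseteq> crossings D" "p \<subseteq> circles D s" using one by (auto simp: enhanced_states_def)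
  then have "finite s" using wf finite_subset by (auto simp: well_formed_def)
  then have "edge_action D u (boundary D (frag_of S))
    = (\<Sum>c\<in>s. frag_cmul ((-1) ^ negatives_above D s c) (edge_action D u (boundary_at D S c)))"
    by (simp add: boundary_def edge_action_def S frag_extend_sum frag_extend_cmul comp_def)
  also have "\<dots> = (\<Sum>c\<in>s. frag_cmul ((-1) ^ negatives_above D s c)
      (if circle_through D s u \<in> p then 0
       else boundary_at D (s, insert (circle_through D s u) p) c))"
    using edge_action_boundary_at[OF wf u s(1) _ s(2)] by (simp add: S)
  also have "\<dots> = boundary D (edge_action D u (frag_of S))"
    by (simp add: boundary_def edge_action_def make_positive_def S)
  finally show ?case .
next
  case (diff a b)
  then show ?case by (simp add: boundary_def edge_action_def frag_extend_diff)
qed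

lemma edge_action_chains:
  assumes wf: "well_formed D" and u: "u \<in> edges D" and a: "a \<in> chains D i j"
  shows "edge_action D u a \<in> chains D i (j + 4)"
proof -
  have "Poly_Mapping.keys (make_positive D u S) \<subseteq> generators D i (j + 4)"
    if "S \<in> generators D i j" for S
  proof (cases "circle_through D (fst S) u \<in> snd S")
    case False
    obtain s p where S: "S = (s, p)" by fastforce
    have p: "p \<subseteq> circles D s" "circle_through D s u \<notin> p" "finite (edges D)"
      using that False wf by (auto simp: S generators_def enhanced_states_def well_formed_def)
    then have "finite p" using finite_circles finite_subset by metis
    then have "tau D (s, insert (circle_through D s u) p) = tau D (s, p) + 2"
      using p u by (simp add: tau_eq circle_through_in_circles)
    then show ?thesis
      using that False u
      by (auto simp: make_positive_def S generators_def enhanced_states_def sigma_def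
          circle_through_in_circles)
  qed (simp add: make_positive_def)
  then show ?thesis
    using a by (auto simp: edge_action_def dest!: subsetD[OF keys_frag_extend])
qed

section \<open>Circles after adding a Hopf circle\<close>

text \<open>
  Both ways of adding a Hopf circle. For \<open>e' = e\<close> the edge \<open>e\<close> is a crossingless component; otherwise
  one end of \<open>e\<close> is renamed to \<open>e'\<close>. Since \<open>e\<close> and \<open>e'\<close> lie on a common circle in every smoothing, sending
  all new edges to \<open>e\<close> recovers the code of \<open>D\<close>, which is what \<open>ends_old\<close> records.
\<close>

locale hopf_clasp =
  fixes D D' :: "('c::linorder, 'e) diagram" and e e' m f g :: 'e and x y :: 'c
  assumes wf: "well_formed D" and e: "e \<in> edges D"
    and xy: "x \<noteq> y" "x \<notin> crossings D" "y \<notin> crossings D"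
    and new: "distinct [m, f, g]" "{m, f, g} \<inter> edges D = {}" "e' = e \<or> e' \<notin> edges D \<union> {m, f, g}"
    and crossings': "crossings D' = crossings D \<union> {x, y}"
    and edges': "edges D' = edges D \<union> {e', m, f, g}"
    and ends_x: "ends D' x = [e, g, m, f]"
    and ends_y: "ends D' y = [g, e', f, m]"
    and ends_old: "c \<in> crossings D \<Longrightarrow> map (\<lambda>v. if v \<in> edges D then v else e) (ends D' c) = ends D c"
    and ends_old_subset: "c \<in> crossings D \<Longrightarrow> set (ends D' c) \<subseteq> edges D \<union> {e'}"
begin

definition contract :: "'e \<Rightarrow> 'e" where
  "contract v = (if v \<in> edges D then v else e)"

text \<open>
  Throughout, \<open>t\<close> is the set of those crossings among \<open>x\<close>, \<open>y\<close> that carry a positive marker. The circles of \<open>D'\<close>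
  that contain no edge of \<open>D\<close> are listed by \<open>extra t\<close>: a half of the new circle closes up with the
  middle piece \<open>m\<close> exactly if the two markers agree.
\<close>

definition extra :: "'c set \<Rightarrow> 'e set set" where
  "extra t = (if t = {x, y} then {{m, f}} else if t = {} then {{m, g}} else {})"

text \<open>
  The circle of \<open>D'\<close> that corresponds to the circle \<open>\<gamma>\<close> of \<open>D\<close>: the circle through \<open>e\<close> absorbs all
  new edges outside \<open>extra t\<close>, and the other circles are unchanged.
\<close>

definition ext :: "'c set \<Rightarrow> 'e set \<Rightarrow> 'e set" where
  "ext t \<gamma> = {v \<in> edges D'. v \<notin> \<Union>(extra t) \<and> contract v \<in> \<gamma>}"

lemma fin: "finite (crossings D)" "finite (edges D)"
  using wf by (auto simp: well_formed_def)

lemma clasp_cases: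
  assumes "t \<subseteq> {x, y}"
  obtains "t = {x, y}" | "t = {x}" | "t = {y}" | "t = {}"
  using assms unfolding Pow_iff[symmetric] by (auto simp: Pow_insert)

lemma extra_simps [simp]:
  "extra {x, y} = {{m, f}}" "extra {} = {{m, g}}" "extra {x} = {}" "extra {y} = {}"
  using xy by (auto simp: extra_def)

lemma contract_in [simp]: "contract v \<in> edges D"
  using e by (simp add: contract_def)

lemma contract_old [simp]: "v \<in> edges D \<Longrightarrow> contract v = v"
  by (simp add: contract_def)

lemma contract_new: "v \<in> {e, e', m, f, g} \<Longrightarrow> contract v = e"
  using new e by (auto simp: contract_def)

lemma extra_subset: "\<Union>(extra t) \<subseteq> {m, f, g}"
  by (auto simp: extra_def)

lemma ends_length: "c \<in> crossings D \<Longrightarrow> length (ends D' c) = 4"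
  using arg_cong[OF ends_old, of c length] wf by (simp add: well_formed_def)

lemma well_formed': "well_formed D'"
  unfolding well_formed_def
proof (intro conjI ballI)
  fix c assume "c \<in> crossings D'"
  then consider "c \<in> crossings D" | "c = x" | "c = y" by (auto simp: crossings')
  then show "length (ends D' c) = 4"
    by cases (simp_all add: ends_x ends_y ends_length)
  from \<open>c \<in> crossings D'\<close> consider "c \<in> crossings D" | "c = x" | "c = y" by (auto simp: crossings')
  then show "set (ends D' c) \<subseteq> edges D'"
    using ends_old_subset e by cases (auto simp: ends_x ends_y edges')
next
  show "finite (crossings D')" "finite (edges D')"
    using fin by (simp_all add: crossings' edges')
qed

lemma arcs_at_old:
  assumes c: "c \<in> crossings D" and t: "t \<subseteq> {x, y}"
  shows "arcs_at D s c = map_prod contract contract ` arcs_at D' (s \<union> t) c"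
proof -
  have "map contract (ends D' c) = ends D c"
    using ends_old[OF c] by (simp add: contract_def[abs_def])
  then have "ends D c ! i = contract (ends D' c ! i)" if "i < 4" for i
    using that ends_length[OF c] by (metis nth_map)
  moreover have "c \<in> s \<union> t \<longleftrightarrow> c \<in> s" using c t xy by blast
  ultimately show ?thesis by (auto simp: arcs_at_def)
qed

lemma arcs_at_old_subset:
  assumes c: "c \<in> crossings D"
  shows "arcs_at D' s c \<subseteq> (edges D \<union> {e'}) \<times> (edges D \<union> {e'})"
proof -
  have "arcs_at D' s c \<subseteq> set (ends D' c) \<times> set (ends D' c)"
    using ends_length[OF c] by (auto simp: arcs_at_def)
  then show ?thesis using ends_old_subset[OF c] by blast
qed

lemma arcs_at_clasp:
  assumes "s \<subseteq> crossings D"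
  shows "arcs_at D' (s \<union> t) x = (if x \<in> t then {(e, g), (m, f)} else {(g, m), (f, e)})"
    and "arcs_at D' (s \<union> t) y = (if y \<in> t then {(g, e'), (f, m)} else {(e', f), (m, g)})"
proof -
  have "x \<notin> s" "y \<notin> s" using assms xy by blast+
  then show "arcs_at D' (s \<union> t) x = (if x \<in> t then {(e, g), (m, f)} else {(g, m), (f, e)})"
    and "arcs_at D' (s \<union> t) y = (if y \<in> t then {(g, e'), (f, m)} else {(e', f), (m, g)})"
    by (simp_all add: arcs_at_def ends_x ends_y)
qed

lemma smoothing_arcs':
  "smoothing_arcs D' s = (\<Union>c\<in>crossings D. arcs_at D' s c) \<union> arcs_at D' s x \<union> arcs_at D' s y"
  by (auto simp: smoothing_arcs_eq crossings')

lemma clasp_arcs: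
  assumes s: "s \<subseteq> crossings D" and t: "t \<subseteq> {x, y}"
    and a: "(v, w) \<in> arcs_at D' (s \<union> t) x \<union> arcs_at D' (s \<union> t) y"
  shows "v \<in> {e, e', m, f, g} \<and> w \<in> {e, e', m, f, g} \<and> (v \<in> \<Union>(extra t) \<longleftrightarrow> w \<in> \<Union>(extra t))"
  using t
proof (cases rule: clasp_cases)
  case 1
  then show ?thesis using a arcs_at_clasp[OF s, of t] new e xy by auto
next
  case 2
  then show ?thesis using a arcs_at_clasp[OF s, of t] xy by auto
next
  case 3
  then show ?thesis using a arcs_at_clasp[OF s, of t] xy by auto
next
  case 4
  then show ?thesis using a arcs_at_clasp[OF s, of t] new e by auto
qed

lemma connected_contract:
  assumes s: "s \<subseteq> crossings D" and t: "t \<subseteq> {x, y}"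
    and v: "v \<in> edges D'" "v \<notin> \<Union>(extra t)"
  shows "(contract v, v) \<in> connection D' (s \<union> t)"
proof (cases "v \<in> edges D")
  case False
  then have cv: "contract v = e" by (simp add: contract_def)
  let ?C = "connection D' (s \<union> t)"
  have "arcs_at D' (s \<union> t) x \<subseteq> ?C" "arcs_at D' (s \<union> t) y \<subseteq> ?C"
    by (auto simp: smoothing_arcs' intro!: arc_connection)
  note arcs = this[unfolded arcs_at_clasp[OF s]]
  have v': "v \<in> {e', m, f, g}" using v False by (auto simp: edges')
  show ?thesis
    unfolding cv using t
  proof (cases rule: clasp_cases)
    case 1
    with arcs have "(e, g) \<in> ?C" "(g, e') \<in> ?C" by auto
    then show "(e, v) \<in> ?C" using v' v(2) 1 connection_trans by auto
  next
    case 2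
    with arcs xy have "(e, g) \<in> ?C" "(m, f) \<in> ?C" "(e', f) \<in> ?C" "(m, g) \<in> ?C" by auto
    then have "(e, g) \<in> ?C" "(g, m) \<in> ?C" "(m, f) \<in> ?C" "(f, e') \<in> ?C"
      by (auto dest: connection_sym)
    note path = this(1) connection_trans[OF this(1,2)]
      connection_trans[OF connection_trans[OF this(1,2)] this(3)]
      connection_trans[OF connection_trans[OF connection_trans[OF this(1,2)] this(3)] this(4)]
    then show "(e, v) \<in> ?C" using v' by auto
  next
    case 3
    with arcs xy have "(g, m) \<in> ?C" "(f, e) \<in> ?C" "(g, e') \<in> ?C" "(f, m) \<in> ?C" by auto
    then have "(e, f) \<in> ?C" "(f, m) \<in> ?C" "(m, g) \<in> ?C" "(g, e') \<in> ?C"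
      by (auto dest: connection_sym)
    note path = this(1) connection_trans[OF this(1,2)]
      connection_trans[OF connection_trans[OF this(1,2)] this(3)]
      connection_trans[OF connection_trans[OF connection_trans[OF this(1,2)] this(3)] this(4)]
    then show "(e, v) \<in> ?C" using v' by auto
  next
    case 4
    with arcs have "(f, e) \<in> ?C" "(e', f) \<in> ?C" by auto
    then have "(e, f) \<in> ?C" "(f, e') \<in> ?C"
      by (auto dest: connection_sym)
    note path = this(1) connection_trans[OF this]
    then show "(e, v) \<in> ?C" using v' v(2) 4 by auto
  qed
qed simp

text \<open>
  The clasp can be contracted to \<open>e\<close> without changing which edges of \<open>D\<close> lie on a common circle,
  because every smoothing joins \<open>e\<close> to \<open>e'\<close> and leaves at most one circle aside.
\<close>

lemma connection_iff:
  assumes s: "s \<subseteq> crossings D" and t: "t \<subseteq> {x, y}" and u: "u \<in> edges D" and v: "v \<in> edges D'"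
  shows "(u, v) \<in> connection D' (s \<union> t) \<longleftrightarrow> v \<notin> \<Union>(extra t) \<and> (u, contract v) \<in> connection D s"
proof
  assume "(u, v) \<in> connection D' (s \<union> t)"
  then show "v \<notin> \<Union>(extra t) \<and> (u, contract v) \<in> connection D s"
  proof (induction rule: connection_induct)
    case refl
    then show ?case using u extra_subset[of t] new by auto
  next
    case (arc v w)
    from arc.hyps(2) consider c where "c \<in> crossings D"
      "(v, w) \<in> arcs_at D' (s \<union> t) c \<or> (w, v) \<in> arcs_at D' (s \<union> t) c"
      | "(v, w) \<in> arcs_at D' (s \<union> t) x \<union> arcs_at D' (s \<union> t) y
         \<or> (w, v) \<in> arcs_at D' (s \<union> t) x \<union> arcs_at D' (s \<union> t) y"
      by (auto simp: smoothing_arcs')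
    then show ?case
    proof cases
      case (1 c)
      then have "w \<in> edges D \<union> {e'}" using arcs_at_old_subset by blast
      then have "w \<notin> \<Union>(extra t)" using extra_subset[of t] new e by blast
      moreover have "(contract v, contract w) \<in> arcs_at D s c \<or> (contract w, contract v) \<in> arcs_at D s c"
        using 1 by (auto simp: arcs_at_old[OF _ t] intro: rev_image_eqI)
      then have "(contract v, contract w) \<in> connection D s"
        using 1(1) arc_connection[of _ _ D s] connection_sym[of _ _ D s]
        by (auto simp: smoothing_arcs_eq)
      ultimately show ?thesis using arc.IH by (blast intro: connection_trans)
    next
      case 2
      then have "v \<in> {e, e', m, f, g}" "w \<in> {e, e', m, f, g}" "v \<in> \<Union>(extra t) \<longleftrightarrow> w \<in> \<Union>(extra t)"
        using clasp_arcs[OF s t] by blast+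
      then show ?thesis using arc.IH by (simp add: contract_new)
    qed
  qed
next
  assume r: "v \<notin> \<Union>(extra t) \<and> (u, contract v) \<in> connection D s"
  have "(u, w) \<in> connection D' (s \<union> t)" if "(u, w) \<in> connection D s" for w
    using that
  proof (induction rule: connection_induct)
    case refl
    then show ?case by simp
  next
    case (arc a b)
    have arc': "(a, b) \<in> connection D' (s \<union> t)" if "(a, b) \<in> smoothing_arcs D s" for a b
    proof -
      obtain c where "c \<in> crossings D" "(a, b) \<in> arcs_at D s c"
        using \<open>(a, b) \<in> smoothing_arcs D s\<close> by (auto simp: smoothing_arcs_eq)
      then obtain a' b' where ab: "a = contract a'" "b = contract b'" "(a', b') \<in> arcs_at D' (s \<union> t) c"
        by (auto simp: arcs_at_old[OF _ t])
      have "a' \<in> edges D \<union> {e'}" "b' \<in> edges D \<union> {e'}"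
        using ab(3) arcs_at_old_subset[OF \<open>c \<in> crossings D\<close>] by blast+
      then have "a' \<in> edges D'" "a' \<notin> \<Union>(extra t)" "b' \<in> edges D'" "b' \<notin> \<Union>(extra t)"
        using extra_subset[of t] new e by (auto simp: edges')
      then have "(a, a') \<in> connection D' (s \<union> t)" "(b, b') \<in> connection D' (s \<union> t)"
        using connected_contract[OF s t] ab by auto
      moreover have "(a', b') \<in> connection D' (s \<union> t)"
        using ab(3) \<open>c \<in> crossings D\<close> by (auto simp: smoothing_arcs' intro!: arc_connection)
      ultimately show ?thesis by (meson connection_sym connection_trans)
    qed
    then show ?case using arc by (meson connection_sym connection_trans)
  qed
  then have "(u, contract v) \<in> connection D' (s \<union> t)" using r by blast
  then show "(u, v) \<in> connection D' (s \<union> t)"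
    using connected_contract[OF s t v] r by (blast intro: connection_trans)
qed

lemma circle_through_old:
  assumes "s \<subseteq> crossings D" "t \<subseteq> {x, y}" "u \<in> edges D"
  shows "circle_through D' (s \<union> t) u = ext t (circle_through D s u)"
  using connection_iff[OF assms] by (auto simp: circle_through_def ext_def)

lemma circle_through_extra:
  assumes s: "s \<subseteq> crossings D" and t: "t \<subseteq> {x, y}" and Z: "Z \<in> extra t" "u \<in> Z"
  shows "circle_through D' (s \<union> t) u = Z"
proof -
  let ?C = "connection D' (s \<union> t)"
  have Zt: "\<Union>(extra t) = Z" using Z by (auto simp: extra_def split: if_splits)
  have "Z \<subseteq> {m, f, g}" using Z extra_subset[of t] by blast
  have outside: "v \<in> Z" if "(u, v) \<in> ?C" "v \<in> edges D'" for v
  proof (rule ccontr)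
    assume "v \<notin> Z"
    have "(contract v, v) \<in> ?C" using connected_contract[OF s t] that \<open>v \<notin> Z\<close> by (simp add: Zt)
    then have "(contract v, u) \<in> ?C" using that(1) by (meson connection_sym connection_trans)
    then show False
      using connection_iff[OF s t contract_in[of v], of u] \<open>Z \<subseteq> {m, f, g}\<close> Z(2) Zt
      by (auto simp: edges')
  qed
  have "arcs_at D' (s \<union> t) x \<subseteq> ?C" "arcs_at D' (s \<union> t) y \<subseteq> ?C"
    by (auto simp: smoothing_arcs' intro!: arc_connection)
  note arcs = this[unfolded arcs_at_clasp[OF s]]
  have inside: "(u, v) \<in> ?C" if "v \<in> Z" for v
    using t
  proof (cases rule: clasp_cases)
    case 1
    then have "Z = {m, f}" "(m, f) \<in> ?C" using Z arcs by auto
    then show ?thesis using that Z(2) connection_sym by auto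
  next
    case 4
    then have "Z = {m, g}" "(m, g) \<in> ?C" using Z arcs by auto
    then show ?thesis using that Z(2) connection_sym by auto
  qed (use Z in simp_all)
  show ?thesis
    using outside inside \<open>Z \<subseteq> {m, f, g}\<close> by (auto simp: circle_through_def edges')
qed

lemma circles':
  assumes s: "s \<subseteq> crossings D" and t: "t \<subseteq> {x, y}"
  shows "circles D' (s \<union> t) = ext t ` circles D s \<union> extra t"
proof
  show "circles D' (s \<union> t) \<subseteq> ext t ` circles D s \<union> extra t"
  proof
    fix \<delta> assume "\<delta> \<in> circles D' (s \<union> t)"
    then obtain v where v: "v \<in> edges D'" "\<delta> = circle_through D' (s \<union> t) v"
      by (auto simp: circles_eq)
    show "\<delta> \<in> ext t ` circles D s \<union> extra t"
    proof (cases "v \<in> \<Union>(extra t)")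
      case True
      then show ?thesis using circle_through_extra[OF s t] v by auto
    next
      case False
      have "\<delta> = circle_through D' (s \<union> t) (contract v)"
        using connected_contract[OF s t v(1) False] v
        by (simp add: circle_through_eq_iff edges' connection_sym)
      then show ?thesis using circle_through_old[OF s t contract_in]
        by (simp add: circle_through_in_circles)
    qed
  qed
  have "Z \<in> circles D' (s \<union> t)" if Z: "Z \<in> extra t" for Z
  proof -
    have m: "m \<in> Z" using Z by (auto simp: extra_def split: if_splits)
    then show ?thesis
      using circle_through_extra[OF s t Z m] circle_through_in_circles[of m D' "s \<union> t"]
      by (simp add: edges')
  qed
  then show "ext t ` circles D s \<union> extra t \<subseteq> circles D' (s \<union> t)"
    using circle_through_old[OF s t]
    by (auto simp: circles_eq edges')
qed

lemma ext_Int: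
  assumes "\<gamma> \<subseteq> edges D"
  shows "ext t \<gamma> \<inter> edges D = \<gamma>"
  using assms extra_subset[of t] new by (auto simp: ext_def edges')

lemma inj_ext: "inj_on (ext t) (circles D s)"
  by (rule inj_onI) (metis circle_subset ext_Int)

lemma ext_eq_iff:
  "\<gamma> \<in> circles D s \<Longrightarrow> \<delta> \<in> circles D s' \<Longrightarrow> ext t \<gamma> = ext t \<delta> \<longleftrightarrow> \<gamma> = \<delta>"
  by (metis circle_subset ext_Int)

lemma ext_not_extra:
  assumes "\<gamma> \<in> circles D s"
  shows "ext t \<gamma> \<notin> extra t'"
proof
  assume "ext t \<gamma> \<in> extra t'"
  then have "ext t \<gamma> \<inter> edges D = {}" using extra_subset[of t'] new(2) by blast
  then show False
    using ext_Int[OF circle_subset[OF assms]] circle_nonempty[OF assms] by simp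
qed

lemma ext_off:
  assumes "\<gamma> \<subseteq> edges D" "e \<notin> \<gamma>"
  shows "ext t \<gamma> = \<gamma>"
proof -
  have "v \<in> edges D" if "contract v \<in> \<gamma>" for v
    using that assms(2) by (auto simp: contract_def split: if_splits)
  then show ?thesis using ext_Int[OF assms(1), of t] by (auto simp: ext_def)
qed

lemma touch_old:
  assumes c: "c \<in> crossings D" and "\<gamma> \<subseteq> edges D"
  shows "ext t \<gamma> \<inter> set (ends D' c) = {} \<longleftrightarrow> \<gamma> \<inter> set (ends D c) = {}"
proof -
  have "set (ends D c) = contract ` set (ends D' c)"
    using arg_cong[OF ends_old[OF c], of set] by (simp add: contract_def[abs_def])
  moreover have "v \<in> edges D' \<and> v \<notin> \<Union>(extra t)" if "v \<in> set (ends D' c)" for v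
    using that ends_old_subset[OF c] extra_subset[of t] new e by (auto simp: edges')
  ultimately show ?thesis
    by (simp add: ext_def disjoint_iff) blast
qed

lemma touch_old_extra:
  assumes c: "c \<in> crossings D" and "Z \<in> extra t"
  shows "Z \<inter> set (ends D' c) = {}"
proof -
  have "Z \<subseteq> {m, f, g}" using assms extra_subset[of t] by blast
  then show ?thesis using ends_old_subset[OF c] new e by blast
qed

lemma touch_clasp:
  assumes w: "w \<in> {x, y}" and "\<gamma> \<subseteq> edges D"
  shows "ext t \<gamma> \<inter> set (ends D' w) = {} \<longleftrightarrow> e \<notin> \<gamma>"
proof -
  have ends: "set (ends D' w) \<subseteq> {e, e', m, f, g}" using w by (auto simp: ends_x ends_y)
  have "ext t \<gamma> \<inter> set (ends D' w) = {}" if "e \<notin> \<gamma>"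
    using that ends by (auto simp: ext_def dest!: contract_new[OF subsetD[OF ends]])
  moreover have "e \<in> ext t \<gamma>" "e' \<in> ext t \<gamma>" if "e \<in> \<gamma>"
    using that e new extra_subset[of t] by (auto simp: ext_def edges' contract_new)
  then have "ext t \<gamma> \<inter> set (ends D' w) \<noteq> {}" if "e \<in> \<gamma>"
    using that w by (auto simp: ends_x ends_y)
  ultimately show ?thesis by blast
qed

lemma touch_clasp_extra:
  assumes "w \<in> {x, y}" "Z \<in> extra t"
  shows "Z \<inter> set (ends D' w) \<noteq> {}"
proof -
  have "m \<in> Z" using assms by (auto simp: extra_def split: if_splits)
  then show ?thesis using assms by (auto simp: ends_x ends_y)
qed

end

section \<open>Transitions after adding a Hopf circle\<close>

context hopf_clasp
begin

text \<open>
  The enhanced state of \<open>D'\<close> that carries positive markers at \<open>t\<close> and positive signs at \<open>z \<subseteq> extra t\<close> and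
  looks like \<open>S\<close> elsewhere. Each generator of \<open>C(D')\<close> has this form in exactly one way
  (\<open>place_exhaust\<close>, \<open>place_eq_iff\<close>); there are six choices for \<open>(t, z)\<close> and accordingly six blocks.
\<close>

definition place ::
  "'c set \<Rightarrow> 'e set set \<Rightarrow> ('c, 'e) enhanced_state \<Rightarrow> ('c, 'e) enhanced_state" where
  "place t z S = (fst S \<union> t, ext t ` snd S \<union> z)"

lemma mem_placed:
  assumes "p \<subseteq> circles D s" "z \<subseteq> extra t"
  shows "\<gamma> \<in> circles D s' \<Longrightarrow> ext t \<gamma> \<in> ext t ` p \<union> z \<longleftrightarrow> \<gamma> \<in> p"
    and "Z \<in> extra t \<Longrightarrow> Z \<in> ext t ` p \<union> z \<longleftrightarrow> Z \<in> z"
proof -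
  assume \<gamma>: "\<gamma> \<in> circles D s'"
  have "ext t \<gamma> \<notin> z" using ext_not_extra[OF \<gamma>] assms(2) by blast
  moreover have "ext t \<gamma> = ext t \<delta> \<longleftrightarrow> \<gamma> = \<delta>" if "\<delta> \<in> p" for \<delta>
    using ext_eq_iff[OF \<gamma>] assms(1) that by blast
  then have "ext t \<gamma> \<in> ext t ` p \<longleftrightarrow> \<gamma> \<in> p" by auto
  ultimately show "ext t \<gamma> \<in> ext t ` p \<union> z \<longleftrightarrow> \<gamma> \<in> p" by blast
next
  assume "Z \<in> extra t"
  then show "Z \<in> ext t ` p \<union> z \<longleftrightarrow> Z \<in> z"
    using ext_not_extra assms(1) by blast
qed

lemma placed_eq_iff:
  assumes "p \<subseteq> circles D s" "q \<subseteq> circles D s'" "z \<subseteq> extra t" "z' \<subseteq> extra t"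
  shows "ext t ` p \<union> z = ext t ` q \<union> z' \<longleftrightarrow> p = q \<and> z = z'"
proof
  assume eq: "ext t ` p \<union> z = ext t ` q \<union> z'"
  have "\<gamma> \<in> p \<longleftrightarrow> \<gamma> \<in> q" if "\<gamma> \<in> p \<union> q" for \<gamma>
  proof -
    have "\<gamma> \<in> circles D s \<or> \<gamma> \<in> circles D s'" using that assms by blast
    then obtain s'' where "\<gamma> \<in> circles D s''" by blast
    then show ?thesis using mem_placed(1)[OF assms(1,3)] mem_placed(1)[OF assms(2,4)] eq by metis
  qed
  moreover have "Z \<in> z \<longleftrightarrow> Z \<in> z'" if "Z \<in> extra t" for Z
    using that mem_placed(2)[OF assms(1,3)] mem_placed(2)[OF assms(2,4)] eq by metis
  ultimately show "p = q \<and> z = z'" using assms(3,4) by blast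
qed simp

lemma placed_subset:
  assumes "s \<subseteq> crossings D" "t \<subseteq> {x, y}" "p \<subseteq> circles D s" "z \<subseteq> extra t"
  shows "ext t ` p \<union> z \<subseteq> circles D' (s \<union> t)"
  using assms circles'[OF assms(1,2)] by blast

lemma placed_exhaust:
  assumes "s \<subseteq> crossings D" "t \<subseteq> {x, y}" "r \<subseteq> circles D' (s \<union> t)"
  obtains q z where "r = ext t ` q \<union> z" "q \<subseteq> circles D s" "z \<subseteq> extra t"
proof
  have "r = h ` {\<gamma> \<in> A. h \<gamma> \<in> r} \<union> (r \<inter> E)" if "r \<subseteq> h ` A \<union> E" for h A and E :: "'e set set"
    using that by blast
  then show "r = ext t ` {\<gamma> \<in> circles D s. ext t \<gamma> \<in> r} \<union> (r \<inter> extra t)"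
    using assms(3) unfolding circles'[OF assms(1,2)] .
qed auto

lemma finite_extra [simp]: "finite (extra t)"
  by (simp add: extra_def)

lemma tau_placed:
  assumes "s \<subseteq> crossings D" "t \<subseteq> {x, y}" "p \<subseteq> circles D s" "z \<subseteq> extra t"
  shows "tau D' (s \<union> t, ext t ` p \<union> z)
    = tau D (s, p) + 2 * int (card z) - int (card (extra t))"
proof -
  have fc: "finite (circles D s)" using fin finite_circles by blast
  have fpz: "finite p" "finite z" using assms(3,4) fc finite_subset finite_extra by metis+
  have disj: "ext t ` circles D s \<inter> extra t = {}" using ext_not_extra by blast
  then have "ext t ` p \<inter> z = {}" using assms by blast
  then have "card (ext t ` p \<union> z) = card (ext t ` p) + card z"
    using fpz by (simp add: card_Un_disjoint)
  also have "card (ext t ` p) = card p"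
    using inj_ext assms(3) by (meson card_image inj_on_subset)
  finally have 1: "card (ext t ` p \<union> z) = card p + card z" .
  have "card (circles D' (s \<union> t)) = card (ext t ` circles D s) + card (extra t)"
    using disj fc by (simp add: circles'[OF assms(1,2)] card_Un_disjoint)
  also have "card (ext t ` circles D s) = card (circles D s)"
    using inj_ext by (rule card_image)
  finally have 2: "card (circles D' (s \<union> t)) = card (circles D s) + card (extra t)" .
  have "finite (edges D')" using fin by (simp add: edges')
  then show ?thesis
    using placed_subset[OF assms] assms(3) fin by (simp add: tau_eq 1 2)
qed

lemma ball_image_Un:
  "(\<forall>\<delta>\<in>(h ` A \<union> E) \<union> (h ` B \<union> E). \<phi> \<delta>) \<longleftrightarrow> (\<forall>\<gamma>\<in>A \<union> B. \<phi> (h \<gamma>)) \<and> (\<forall>Z\<in>E. \<phi> Z)"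
  by blast

text \<open>
  A change of marker at an old crossing happens inside a block and does not see the extra circle,
  which does not touch that crossing.
\<close>

lemma transitions_old:
  assumes s: "s \<subseteq> crossings D" "c \<in> s" and t: "t \<subseteq> {x, y}" and p: "p \<subseteq> circles D s"
    and z: "z \<subseteq> extra t"
  shows "transitions D' (s \<union> t) (ext t ` p \<union> z) c
    = (\<lambda>q. ext t ` q \<union> z) ` transitions D s p c"
proof -
  have c: "c \<in> crossings D" using s by blast
  have s': "s - {c} \<subseteq> crossings D" using s by blast
  have "c \<notin> t" using c t xy by blast
  then have st: "(s \<union> t) - {c} = (s - {c}) \<union> t" by blast
  have iff: "ext t ` q \<union> z' \<in> transitions D' (s \<union> t) (ext t ` p \<union> z) c
      \<longleftrightarrow> q \<in> transitions D s p c \<and> z' = z"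
    if q: "q \<subseteq> circles D (s - {c})" and z': "z' \<subseteq> extra t" for q z'
  proof -
    have off: "(\<forall>\<delta> \<in> circles D' (s \<union> t) \<union> circles D' (s - {c} \<union> t). \<delta> \<inter> set (ends D' c) = {} \<longrightarrow>
        (\<delta> \<in> ext t ` p \<union> z \<longleftrightarrow> \<delta> \<in> ext t ` q \<union> z'))
      \<longleftrightarrow> (\<forall>\<gamma> \<in> circles D s \<union> circles D (s - {c}). \<gamma> \<inter> set (ends D c) = {} \<longrightarrow>
        (\<gamma> \<in> p \<longleftrightarrow> \<gamma> \<in> q)) \<and> z' = z" (is "?A \<longleftrightarrow> ?B \<and> _")
    proof -
      have "?A \<longleftrightarrow> (\<forall>\<gamma> \<in> circles D s \<union> circles D (s - {c}). ext t \<gamma> \<inter> set (ends D' c) = {} \<longrightarrow>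
          (ext t \<gamma> \<in> ext t ` p \<union> z \<longleftrightarrow> ext t \<gamma> \<in> ext t ` q \<union> z'))
        \<and> (\<forall>Z \<in> extra t. Z \<inter> set (ends D' c) = {} \<longrightarrow>
          (Z \<in> ext t ` p \<union> z \<longleftrightarrow> Z \<in> ext t ` q \<union> z'))"
        unfolding circles'[OF s(1) t] circles'[OF s' t] by (rule ball_image_Un)
      also have "(\<forall>\<gamma> \<in> circles D s \<union> circles D (s - {c}). ext t \<gamma> \<inter> set (ends D' c) = {} \<longrightarrow>
          (ext t \<gamma> \<in> ext t ` p \<union> z \<longleftrightarrow> ext t \<gamma> \<in> ext t ` q \<union> z')) \<longleftrightarrow> ?B"
      proof (rule ball_cong[OF refl])
        fix \<gamma> assume "\<gamma> \<in> circles D s \<union> circles D (s - {c})"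
        then obtain s'' where \<gamma>: "\<gamma> \<in> circles D s''" by blast
        show "(ext t \<gamma> \<inter> set (ends D' c) = {} \<longrightarrow>
          (ext t \<gamma> \<in> ext t ` p \<union> z \<longleftrightarrow> ext t \<gamma> \<in> ext t ` q \<union> z'))
          \<longleftrightarrow> (\<gamma> \<inter> set (ends D c) = {} \<longrightarrow> (\<gamma> \<in> p \<longleftrightarrow> \<gamma> \<in> q))"
          unfolding mem_placed(1)[OF p z \<gamma>] mem_placed(1)[OF q z' \<gamma>]
            touch_old[OF c circle_subset[OF \<gamma>]] ..
      qed
      also have "(\<forall>Z \<in> extra t. Z \<inter> set (ends D' c) = {} \<longrightarrow>
          (Z \<in> ext t ` p \<union> z \<longleftrightarrow> Z \<in> ext t ` q \<union> z')) \<longleftrightarrow> (\<forall>Z \<in> extra t. Z \<in> z \<longleftrightarrow> Z \<in> z')"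
      proof (rule ball_cong[OF refl])
        fix Z assume Z: "Z \<in> extra t"
        show "(Z \<inter> set (ends D' c) = {} \<longrightarrow> (Z \<in> ext t ` p \<union> z \<longleftrightarrow> Z \<in> ext t ` q \<union> z'))
          \<longleftrightarrow> (Z \<in> z \<longleftrightarrow> Z \<in> z')"
          unfolding mem_placed(2)[OF p z Z] mem_placed(2)[OF q z' Z]
          using touch_old_extra[OF c Z] by simp
      qed
      also have "\<dots> \<longleftrightarrow> z' = z" using z z' by blast
      finally show ?thesis .
    qed
    have "ext t ` q \<union> z' \<subseteq> circles D' (s - {c} \<union> t)" by (rule placed_subset[OF s' t q z'])
    then show ?thesis
      unfolding transitions_def mem_Collect_eq st off tau_placed[OF s(1) t p z]
        tau_placed[OF s' t q z'] using q by auto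
  qed
  show ?thesis
  proof (intro equalityI subsetI)
    fix r assume r: "r \<in> transitions D' (s \<union> t) (ext t ` p \<union> z) c"
    then have "r \<subseteq> circles D' (s - {c} \<union> t)" by (simp add: transitions_def st)
    then obtain q z' where "r = ext t ` q \<union> z'" "q \<subseteq> circles D (s - {c})" "z' \<subseteq> extra t"
      using placed_exhaust[OF s' t] by metis
    then have "q \<in> transitions D s p c" "r = ext t ` q \<union> z" using iff[of q z'] r by simp_all
    then show "r \<in> (\<lambda>q. ext t ` q \<union> z) ` transitions D s p c" by (rule rev_image_eqI)
  next
    fix r assume "r \<in> (\<lambda>q. ext t ` q \<union> z) ` transitions D s p c"
    then obtain q where "q \<in> transitions D s p c" "r = ext t ` q \<union> z" by blast
    moreover from this have "q \<subseteq> circles D (s - {c})" by (simp add: transitions_def)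
    ultimately show "r \<in> transitions D' (s \<union> t) (ext t ` p \<union> z) c" using iff[of q z] z by simp
  qed
qed

text \<open>
  A change of marker at a clasp crossing touches only the circle through \<open>e\<close> and the extra circle.
  What remains of the condition on \<open>tau\<close> is a comparison of the numbers of positive circles.
\<close>

lemma transitions_clasp:
  assumes s: "s \<subseteq> crossings D" and t: "t \<subseteq> {x, y}" and w: "w \<in> t" and p: "p \<subseteq> circles D s"
    and z: "z \<subseteq> extra t" and q: "q \<subseteq> circles D s" and z': "z' \<subseteq> extra (t - {w})"
  defines "\<gamma>\<^sub>e \<equiv> circle_through D s e"
  shows "ext (t - {w}) ` q \<union> z' \<in> transitions D' (s \<union> t) (ext t ` p \<union> z) w \<longleftrightarrow>
    (\<forall>\<gamma>\<in>circles D s. \<gamma> \<noteq> \<gamma>\<^sub>e \<longrightarrow> (\<gamma> \<in> p \<longleftrightarrow> \<gamma> \<in> q)) \<and>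
    2 * int (card q) + 2 * int (card z') - int (card (extra (t - {w})))
      = 2 * int (card p) + 2 * int (card z) - int (card (extra t)) + 1"
proof -
  let ?t' = "t - {w}"
  have w': "w \<in> {x, y}" using t w by blast
  have t': "?t' \<subseteq> {x, y}" using t by blast
  have "w \<notin> s" using w' s xy by blast
  then have st: "(s \<union> t) - {w} = s \<union> ?t'" by (simp add: Un_Diff)
  have e_iff: "e \<in> \<gamma> \<longleftrightarrow> \<gamma> = \<gamma>\<^sub>e" if "\<gamma> \<in> circles D s" for \<gamma>
    using circle_through_eq[OF that, of e] in_circle_through[OF e, of s] unfolding \<gamma>\<^sub>e_def by metis
  have off: "(\<forall>\<delta> \<in> circles D' (s \<union> t) \<union> circles D' (s \<union> ?t'). \<delta> \<inter> set (ends D' w) = {} \<longrightarrow>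
        (\<delta> \<in> ext t ` p \<union> z \<longleftrightarrow> \<delta> \<in> ext ?t' ` q \<union> z'))
      \<longleftrightarrow> (\<forall>\<gamma>\<in>circles D s. \<gamma> \<noteq> \<gamma>\<^sub>e \<longrightarrow> (\<gamma> \<in> p \<longleftrightarrow> \<gamma> \<in> q))" (is "?A \<longleftrightarrow> ?B")
  proof -
    have mem: "\<gamma> \<in> ext t ` p \<union> z \<longleftrightarrow> \<gamma> \<in> p" "\<gamma> \<in> ext ?t' ` q \<union> z' \<longleftrightarrow> \<gamma> \<in> q"
      if "\<gamma> \<in> circles D s" "\<gamma> \<noteq> \<gamma>\<^sub>e" for \<gamma>
      using mem_placed(1)[OF p z that(1)] mem_placed(1)[OF q z' that(1)]
        ext_off[OF circle_subset[OF that(1)]] e_iff[OF that(1)] that(2) by simp_all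
    have "{\<delta> \<in> circles D' (s \<union> t') . \<delta> \<inter> set (ends D' w) = {}} = circles D s - {\<gamma>\<^sub>e}"
      if "t' \<subseteq> {x, y}" for t'
    proof -
      have "ext t' \<gamma> \<inter> set (ends D' w) = {} \<longleftrightarrow> \<gamma> \<noteq> \<gamma>\<^sub>e" if "\<gamma> \<in> circles D s" for \<gamma>
        using touch_clasp[OF w' circle_subset[OF that], of t'] e_iff[OF that] by simp
      then have 1: "{\<gamma> \<in> circles D s. ext t' \<gamma> \<inter> set (ends D' w) = {}} = circles D s - {\<gamma>\<^sub>e}"
        by auto
      have 2: "{Z \<in> extra t'. Z \<inter> set (ends D' w) = {}} = {}"
        using touch_clasp_extra[OF w'] by auto
      have "{\<delta> \<in> h ` A \<union> E. \<delta> \<inter> W = {}}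
          = h ` {\<gamma> \<in> A. h \<gamma> \<inter> W = {}} \<union> {Z \<in> E. Z \<inter> W = {}}"
        for h :: "'e set \<Rightarrow> 'e set" and A E W by blast
      then have "{\<delta> \<in> circles D' (s \<union> t') . \<delta> \<inter> set (ends D' w) = {}}
          = ext t' ` (circles D s - {\<gamma>\<^sub>e})"
        unfolding circles'[OF s that] by (simp only: 1 2 Un_empty_right)
      also have "\<dots> = (\<lambda>\<gamma>. \<gamma>) ` (circles D s - {\<gamma>\<^sub>e})"
      proof (rule image_cong[OF refl])
        fix \<gamma> assume "\<gamma> \<in> circles D s - {\<gamma>\<^sub>e}"
        then show "ext t' \<gamma> = \<gamma>" using ext_off[OF circle_subset] e_iff by blast
      qed
      finally show ?thesis by simp
    qed
    note off_clasp = this[OF t] this[OF t']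
    have "(\<forall>\<delta>\<in>A \<union> B. \<phi> \<delta> \<longrightarrow> \<psi> \<delta>) \<longleftrightarrow> (\<forall>\<delta>\<in>{\<delta> \<in> A. \<phi> \<delta>} \<union> {\<delta> \<in> B. \<phi> \<delta>}. \<psi> \<delta>)"
      for A B :: "'e set set" and \<phi> \<psi> by blast
    then have "?A \<longleftrightarrow> (\<forall>\<delta>\<in>circles D s - {\<gamma>\<^sub>e}. \<delta> \<in> ext t ` p \<union> z \<longleftrightarrow> \<delta> \<in> ext ?t' ` q \<union> z')"
      by (simp only: off_clasp Un_absorb)
    also have "\<dots> \<longleftrightarrow> (\<forall>\<delta>\<in>circles D s - {\<gamma>\<^sub>e}. \<delta> \<in> p \<longleftrightarrow> \<delta> \<in> q)"
    proof (rule ball_cong[OF refl])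
      fix \<delta> assume "\<delta> \<in> circles D s - {\<gamma>\<^sub>e}"
      then have d: "\<delta> \<in> circles D s" "\<delta> \<noteq> \<gamma>\<^sub>e" by simp_all
      show "(\<delta> \<in> ext t ` p \<union> z \<longleftrightarrow> \<delta> \<in> ext ?t' ` q \<union> z') \<longleftrightarrow> (\<delta> \<in> p \<longleftrightarrow> \<delta> \<in> q)"
        by (simp only: mem[OF d])
    qed
    also have "\<dots> \<longleftrightarrow> ?B" by (simp add: Ball_def imp_conjL)
    finally show ?thesis .
  qed
  have "tau D (s, p) = 2 * int (card p) - int (card (circles D s))"
    "tau D (s, q) = 2 * int (card q) - int (card (circles D s))"
    using p q fin by (simp_all add: tau_eq)
  moreover have "ext ?t' ` q \<union> z' \<subseteq> circles D' (s \<union> ?t')" by (rule placed_subset[OF s t' q z'])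
  ultimately show ?thesis
    unfolding transitions_def mem_Collect_eq st off tau_placed[OF s t p z]
      tau_placed[OF s t' q z'] by auto
qed

text \<open>
  The number of positive circles shows whether the sign of \<open>\<delta>\<close> is kept or turns from negative to
  positive. These are the only two cases that occur at a clasp crossing.
\<close>

lemma agree_off_circle:
  assumes p: "p \<subseteq> circles D s" and q: "q \<subseteq> circles D s"
    and off: "\<forall>\<gamma>\<in>circles D s. \<gamma> \<noteq> \<delta> \<longrightarrow> (\<gamma> \<in> p \<longleftrightarrow> \<gamma> \<in> q)"
  shows "card q = card p \<longleftrightarrow> q = p"
    and "card q = Suc (card p) \<longleftrightarrow> \<delta> \<notin> p \<and> q = insert \<delta> p"
proof -
  have fp: "finite p" "finite q" using p q fin finite_circles finite_subset by metis+
  have same: "p - {\<delta>} = q - {\<delta>}"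
  proof (rule Set.set_eqI)
    fix \<gamma>
    have "\<gamma> \<in> circles D s" if "\<gamma> \<in> p \<or> \<gamma> \<in> q" using that p q by blast
    then have "\<gamma> \<noteq> \<delta> \<Longrightarrow> \<gamma> \<in> p \<longleftrightarrow> \<gamma> \<in> q" using off by metis
    then show "\<gamma> \<in> p - {\<delta>} \<longleftrightarrow> \<gamma> \<in> q - {\<delta>}" unfolding Diff_iff singleton_iff by metis
  qed
  have "(card q = card p \<longleftrightarrow> q = p) \<and> (card q = Suc (card p) \<longleftrightarrow> \<delta> \<notin> p \<and> q = insert \<delta> p)"
  proof (cases "\<delta> \<in> p"; cases "\<delta> \<in> q")
    assume "\<delta> \<in> p" "\<delta> \<in> q"
    have "q = insert \<delta> (q - {\<delta>})" by (rule insert_Diff[OF \<open>\<delta> \<in> q\<close>, symmetric])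
    also have "\<dots> = insert \<delta> (p - {\<delta>})" by (simp only: same)
    also have "\<dots> = p" by (rule insert_Diff[OF \<open>\<delta> \<in> p\<close>])
    finally show ?thesis using \<open>\<delta> \<in> p\<close> by simp
  next
    assume "\<delta> \<in> p" "\<delta> \<notin> q"
    have "p = insert \<delta> (p - {\<delta>})" by (rule insert_Diff[OF \<open>\<delta> \<in> p\<close>, symmetric])
    also have "\<dots> = insert \<delta> q" unfolding same by (rule insert_Diff_single)
    finally have "card p = Suc (card q)"
      using card_insert_disjoint[OF fp(2) \<open>\<delta> \<notin> q\<close>] by (simp only:)
    then show ?thesis using \<open>\<delta> \<in> p\<close> \<open>\<delta> \<notin> q\<close> by auto
  next
    assume "\<delta> \<notin> p" "\<delta> \<in> q"
    have "q = insert \<delta> (q - {\<delta>})" by (rule insert_Diff[OF \<open>\<delta> \<in> q\<close>, symmetric])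
    also have "\<dots> = insert \<delta> p" unfolding same[symmetric] by (rule insert_Diff_single)
    finally have q: "q = insert \<delta> p" .
    then have "card q = Suc (card p)"
      using card_insert_disjoint[OF fp(1) \<open>\<delta> \<notin> p\<close>] by (simp only:)
    then show ?thesis using \<open>\<delta> \<notin> p\<close> q by (metis n_not_Suc_n)
  next
    assume "\<delta> \<notin> p" "\<delta> \<notin> q"
    have "q = q - {\<delta>}" using \<open>\<delta> \<notin> q\<close> by simp
    also have "\<dots> = p - {\<delta>}" by (rule same[symmetric])
    also have "\<dots> = p" using \<open>\<delta> \<notin> p\<close> by simp
    finally show ?thesis using \<open>\<delta> \<notin> p\<close> by auto
  qed
  then show "card q = card p \<longleftrightarrow> q = p"
    and "card q = Suc (card p) \<longleftrightarrow> \<delta> \<notin> p \<and> q = insert \<delta> p" by blast+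
qed

end

section \<open>The differential after adding a Hopf circle\<close>

context hopf_clasp
begin

text \<open>
  A sign for each generator. In \<open>C(D')\<close> the old part of the differential picks up a sign for each negative
  marker at \<open>x\<close> or \<open>y\<close> that is bigger than the crossing being changed, and the parts at \<open>x\<close> and \<open>y\<close> pick up
  signs for the negative markers of the old crossings. Multiplying each generator with the signs that
  the changes already made at \<open>x\<close> and \<open>y\<close> carry leaves one constant sign of the second kind and reduces
  the first kind to the constant \<open>parity t\<close> on each block. The factor \<open>-1\<close> for \<open>y < x\<close> makes the outcome
  independent of how \<open>x\<close> and \<open>y\<close> are ordered.
\<close>

definition twist :: "'c set \<Rightarrow> 'c set \<Rightarrow> int" where
  "twist t s = (if t = {} \<and> y < x then -1 else 1)
     * (if x \<in> t then 1 else (-1) ^ negatives_above D s x)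
     * (if y \<in> t then 1 else (-1) ^ negatives_above D s y)"

definition parity :: "'c set \<Rightarrow> int" where
  "parity t = (if x \<in> t then 1 else -1) * (if y \<in> t then 1 else -1)"

lemma Un_remove: "w \<notin> s \<Longrightarrow> (s \<union> t) - {w} = s \<union> (t - {w})"
  by (simp add: Un_Diff)

lemma twist_square: "twist t s * twist t s = 1"
proof -
  have sq: "(-1) ^ n * (-1) ^ n = (1::int)" for n :: nat
    by (simp flip: power_add mult_2)
  have "(a * b * c) * (a * b * c) = (a * a) * (b * b) * (c * c)" for a b c :: int
    by (simp add: algebra_simps)
  then show ?thesis unfolding twist_def by (simp only:) (simp add: sq)
qed

lemma negatives_above':
  assumes s: "s \<subseteq> crossings D" and t: "t \<subseteq> {x, y}"
  shows "negatives_above D' (s \<union> t) c = negatives_above D s c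
    + (if x \<notin> t \<and> c < x then 1 else 0) + (if y \<notin> t \<and> c < y then 1 else 0)"
proof -
  have notin: "x \<notin> s" "y \<notin> s" using s xy by blast+
  have "{c' \<in> crossings D' - (s \<union> t). c < c'}
      = {c' \<in> crossings D - s. c < c'} \<union> {w \<in> {x, y}. w \<notin> t \<and> c < w}" (is "_ = ?A \<union> ?B")
  proof (rule Set.set_eqI)
    fix c' show "c' \<in> {c' \<in> crossings D' - (s \<union> t). c < c'} \<longleftrightarrow> c' \<in> ?A \<union> ?B"
      using notin t xy by (auto simp: crossings')
  qed
  moreover have "?A \<inter> ?B = {}" using xy by auto
  moreover have "finite ?A" "finite ?B" using fin by auto
  ultimately have "negatives_above D' (s \<union> t) c = negatives_above D s c + card ?B"
    by (simp add: negatives_above_def card_Un_disjoint)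
  moreover have "?B = (if x \<notin> t \<and> c < x then {x} else {}) \<union> (if y \<notin> t \<and> c < y then {y} else {})"
    by auto
  then have "card ?B = (if x \<notin> t \<and> c < x then 1 else 0) + (if y \<notin> t \<and> c < y then 1 else 0)"
    using xy(1) by simp
  ultimately show ?thesis by simp
qed

lemma negatives_above_remove:
  assumes s: "s \<subseteq> crossings D" "c \<in> s"
  shows "negatives_above D (s - {c}) w = negatives_above D s w + (if w < c then 1 else 0)"
proof -
  have "{c' \<in> crossings D - (s - {c}). w < c'}
      = {c' \<in> crossings D - s. w < c'} \<union> (if w < c then {c} else {})" (is "_ = ?A \<union> ?B")
  proof (rule Set.set_eqI)
    fix c' show "c' \<in> {c' \<in> crossings D - (s - {c}). w < c'} \<longleftrightarrow> c' \<in> ?A \<union> ?B"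
      using s by (cases "c' = c") auto
  qed
  moreover have "?A \<inter> ?B = {}" using s by auto
  moreover have "finite ?A" "finite ?B" using fin by auto
  ultimately have "negatives_above D (s - {c}) w = negatives_above D s w + card ?B"
    by (simp add: negatives_above_def card_Un_disjoint)
  then show ?thesis by simp
qed

text \<open>
  Passing to \<open>s - {c}\<close> changes \<open>twist\<close> by a sign for each negative \<open>w\<close> among \<open>x\<close>, \<open>y\<close> with \<open>w < c\<close>, while the
  differential sees those with \<open>c < w\<close>. Exactly one of the two occurs, so together each negative \<open>w\<close>
  contributes one factor \<open>-1\<close>.
\<close>

lemma sign_old:
  assumes s: "s \<subseteq> crossings D" "c \<in> s" and t: "t \<subseteq> {x, y}"
  shows "twist t s * (-1) ^ negatives_above D' (s \<union> t) c
    = parity t * (-1) ^ negatives_above D s c * twist t (s - {c})"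
proof -
  have "c \<noteq> x" "c \<noteq> y" using s xy by blast+
  then have "c < x \<longleftrightarrow> \<not> x < c" "c < y \<longleftrightarrow> \<not> y < c" by auto
  then show ?thesis
    unfolding twist_def parity_def negatives_above'[OF s(1) t] negatives_above_remove[OF s]
    by (cases "x < c"; cases "y < c"; cases "x \<in> t"; cases "y \<in> t") simp_all
qed

text \<open>
  Of the four edges of the square of markers at \<open>x\<close> and \<open>y\<close> exactly one carries a sign, as it must for the
  square to anticommute.
\<close>

lemma sign_clasp:
  assumes s: "s \<subseteq> crossings D" and t: "t \<subseteq> {x, y}" and w: "w \<in> t"
  shows "twist t s * (-1) ^ negatives_above D' (s \<union> t) w
    = (if t = {x} then -1 else 1) * twist (t - {w}) s"
proof -
  have cmp: "x < y \<longleftrightarrow> \<not> y < x" using xy(1) by auto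
  consider "t = {x, y}" "w = x" | "t = {x, y}" "w = y" | "t = {x}" "w = x" | "t = {y}" "w = y"
    using t by (cases rule: clasp_cases) (use w in auto)
  then show ?thesis
    unfolding negatives_above'[OF s t]
  proof cases
    case 1
    then have "t - {w} = {y}" using xy(1) by auto
    then show "twist t s * (-1) ^ (negatives_above D s w + (if x \<notin> t \<and> w < x then 1 else 0)
      + (if y \<notin> t \<and> w < y then 1 else 0)) = (if t = {x} then -1 else 1) * twist (t - {w}) s"
      using 1 xy(1) by (simp add: twist_def)
  next
    case 2
    then have "t - {w} = {x}" using xy(1) by auto
    then show "twist t s * (-1) ^ (negatives_above D s w + (if x \<notin> t \<and> w < x then 1 else 0)
      + (if y \<notin> t \<and> w < y then 1 else 0)) = (if t = {x} then -1 else 1) * twist (t - {w}) s"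
      using 2 xy(1) by (simp add: twist_def)
  next
    case 3
    then show "twist t s * (-1) ^ (negatives_above D s w + (if x \<notin> t \<and> w < x then 1 else 0)
      + (if y \<notin> t \<and> w < y then 1 else 0)) = (if t = {x} then -1 else 1) * twist (t - {w}) s"
      using xy(1) cmp by (simp add: twist_def)
  next
    case 4
    then show "twist t s * (-1) ^ (negatives_above D s w + (if x \<notin> t \<and> w < x then 1 else 0)
      + (if y \<notin> t \<and> w < y then 1 else 0)) = (if t = {x} then -1 else 1) * twist (t - {w}) s"
      using xy(1) cmp by (simp add: twist_def)
  qed
qed

definition block_incl ::
  "'c set \<Rightarrow> 'e set set \<Rightarrow> (('c, 'e) enhanced_state \<Rightarrow>\<^sub>0 int) \<Rightarrow> (('c, 'e) enhanced_state \<Rightarrow>\<^sub>0 int)"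
  where "block_incl t z = frag_extend (\<lambda>S. frag_cmul (twist t (fst S)) (frag_of (place t z S)))"

lemma block_incl_frag_of [simp]:
  "block_incl t z (frag_of S) = frag_cmul (twist t (fst S)) (frag_of (place t z S))"
  by (simp add: block_incl_def)

lemma block_incl_boundary_at:
  assumes s: "s \<subseteq> crossings D" "c \<in> s" and t: "t \<subseteq> {x, y}" and p: "p \<subseteq> circles D s"
    and z: "z \<subseteq> extra t"
  shows "block_incl t z (boundary_at D (s, p) c)
    = frag_cmul (twist t (s - {c})) (boundary_at D' (place t z (s, p)) c)"
proof -
  let ?T = "transitions D s p c"
  have "c \<notin> t" using s t xy by blast
  then have st: "(s \<union> t) - {c} = (s - {c}) \<union> t" by (simp add: Un_Diff)
  have sub: "q \<subseteq> circles D (s - {c})" if "q \<in> ?T" for q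
    using that by (simp add: transitions_def)
  have inj: "inj_on (\<lambda>q. ext t ` q \<union> z) ?T"
    by (rule inj_onI) (simp only: placed_eq_iff[OF sub sub z z])
  have "block_incl t z (boundary_at D (s, p) c)
      = (\<Sum>q\<in>?T. frag_cmul (twist t (s - {c})) (frag_of (place t z (s - {c}, q))))"
    using fin by (simp add: block_incl_def boundary_at_def frag_extend_sum finite_transitions comp_def)
  also have "\<dots> = frag_cmul (twist t (s - {c}))
      (\<Sum>q\<in>?T. frag_of ((s - {c}) \<union> t, ext t ` q \<union> z))"
    by (simp add: frag_cmul_sum place_def)
  also have "(\<Sum>q\<in>?T. frag_of ((s - {c}) \<union> t, ext t ` q \<union> z))
      = (\<Sum>r\<in>(\<lambda>q. ext t ` q \<union> z) ` ?T. frag_of ((s - {c}) \<union> t, r))"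
    by (simp add: sum.reindex[OF inj])
  also have "\<dots> = boundary_at D' (place t z (s, p)) c"
    by (simp add: boundary_at_def place_def st transitions_old[OF s t p z])
  finally show ?thesis .
qed

lemma boundary_block_incl:
  assumes S: "(s, p) \<in> enhanced_states D" and t: "t \<subseteq> {x, y}" and z: "z \<subseteq> extra t"
  shows "boundary D' (block_incl t z (frag_of (s, p)))
    = frag_cmul (parity t) (block_incl t z (boundary D (frag_of (s, p))))
      + (\<Sum>w\<in>t. frag_cmul ((if t = {x} then -1 else 1) * twist (t - {w}) s)
          (boundary_at D' (place t z (s, p)) w))"
proof -
  have s: "s \<subseteq> crossings D" and p: "p \<subseteq> circles D s" using S by (auto simp: enhanced_states_def)
  have f: "finite s" "finite t" using s t fin finite_subset by (metis, metis finite.simps)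
  have disj: "s \<inter> t = {}" using s t xy by blast
  let ?n = "negatives_above D' (s \<union> t)" and ?b = "boundary_at D' (place t z (s, p))"
  have "boundary D' (block_incl t z (frag_of (s, p)))
      = frag_cmul (twist t s) (\<Sum>c\<in>s \<union> t. frag_cmul ((-1) ^ ?n c) (?b c))"
    by (simp add: boundary_def frag_extend_cmul place_def)
  also have "\<dots> = (\<Sum>c\<in>s. frag_cmul (twist t s * (-1) ^ ?n c) (?b c))
      + (\<Sum>w\<in>t. frag_cmul (twist t s * (-1) ^ ?n w) (?b w))"
    using f disj by (simp add: sum.union_disjoint frag_cmul_sum frag_cmul_distrib2)
  also have "(\<Sum>c\<in>s. frag_cmul (twist t s * (-1) ^ ?n c) (?b c))
      = (\<Sum>c\<in>s. frag_cmul (parity t * (-1) ^ negatives_above D s c)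
           (block_incl t z (boundary_at D (s, p) c)))"
  proof (rule sum.cong[OF refl])
    fix c assume c: "c \<in> s"
    show "frag_cmul (twist t s * (-1) ^ ?n c) (?b c)
        = frag_cmul (parity t * (-1) ^ negatives_above D s c) (block_incl t z (boundary_at D (s, p) c))"
      by (simp only: sign_old[OF s c t] block_incl_boundary_at[OF s c t p z] frag_cmul_cmul)
  qed
  also have "\<dots> = frag_cmul (parity t) (block_incl t z (boundary D (frag_of (s, p))))"
    using f by (simp add: boundary_def block_incl_def frag_extend_sum frag_extend_cmul frag_cmul_sum comp_def)
  also have "(\<Sum>w\<in>t. frag_cmul (twist t s * (-1) ^ ?n w) (?b w))
      = (\<Sum>w\<in>t. frag_cmul ((if t = {x} then -1 else 1) * twist (t - {w}) s) (?b w))"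
    by (rule sum.cong[OF refl]) (simp only: sign_clasp[OF s t])
  finally show ?thesis .
qed

lemma transitions_clasp_image:
  assumes s: "s \<subseteq> crossings D" and t: "t \<subseteq> {x, y}" and w: "w \<in> t" and p: "p \<subseteq> circles D s"
    and z: "z \<subseteq> extra t"
  shows "transitions D' (s \<union> t) (ext t ` p \<union> z) w
    = (\<lambda>(q, z'). ext (t - {w}) ` q \<union> z') ` {(q, z'). q \<subseteq> circles D s \<and> z' \<subseteq> extra (t - {w}) \<and>
        (\<forall>\<gamma>\<in>circles D s. \<gamma> \<noteq> circle_through D s e \<longrightarrow> (\<gamma> \<in> p \<longleftrightarrow> \<gamma> \<in> q)) \<and>
        2 * int (card q) + 2 * int (card z') - int (card (extra (t - {w})))
          = 2 * int (card p) + 2 * int (card z) - int (card (extra t)) + 1}"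
    (is "?L = ?h ` ?R")
proof (intro equalityI subsetI)
  fix r assume r: "r \<in> ?L"
  have "w \<notin> s" using w t s xy by blast
  then have "(s \<union> t) - {w} = s \<union> (t - {w})" by (simp add: Un_Diff)
  then have "r \<subseteq> circles D' (s \<union> (t - {w}))" using r by (simp add: transitions_def)
  moreover have "t - {w} \<subseteq> {x, y}" using t by blast
  ultimately obtain q z' where q: "r = ext (t - {w}) ` q \<union> z'" "q \<subseteq> circles D s" "z' \<subseteq> extra (t - {w})"
    using placed_exhaust[OF s] by metis
  then have "(q, z') \<in> ?R" using r transitions_clasp[OF s t w p z q(2,3)] by simp
  then show "r \<in> ?h ` ?R" by (rule rev_image_eqI) (simp add: q(1))
next
  fix r assume "r \<in> ?h ` ?R"
  then obtain q z' where "(q, z') \<in> ?R" "r = ext (t - {w}) ` q \<union> z'" by auto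
  then show "r \<in> ?L" using transitions_clasp[OF s t w p z, of q z'] by simp
qed

text \<open>
  Merging a positive extra circle into the circle through \<open>e\<close> is multiplication by \<open>X\<close>.
\<close>

lemma boundary_at_merge_positive:
  assumes S: "(s, p) \<in> enhanced_states D" and w: "w \<in> {x, y}"
  shows "boundary_at D' (place {x, y} {{m, f}} (s, p)) w
    = (if circle_through D s e \<in> p then 0
       else frag_of (place ({x, y} - {w}) {} (s, insert (circle_through D s e) p)))"
proof -
  have s: "s \<subseteq> crossings D" and p: "p \<subseteq> circles D s" using S by (auto simp: enhanced_states_def)
  let ?\<gamma> = "circle_through D s e" and ?t' = "{x, y} - {w}"
  have \<gamma>: "?\<gamma> \<in> circles D s" using e by (rule circle_through_in_circles)
  have "w \<notin> s" using s w xy by blast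
  then have st: "(s \<union> {x, y}) - {w} = s \<union> ?t'" by (rule Un_remove)
  have ex: "extra ?t' = {}" using w xy(1) by (auto simp: extra_def)
  have z: "{{m, f}} \<subseteq> extra {x, y}" by simp
  have count: "{(q, z'). q \<subseteq> circles D s \<and> z' \<subseteq> extra ?t' \<and>
        (\<forall>\<gamma>\<in>circles D s. \<gamma> \<noteq> ?\<gamma> \<longrightarrow> (\<gamma> \<in> p \<longleftrightarrow> \<gamma> \<in> q)) \<and>
        2 * int (card q) + 2 * int (card z') - int (card (extra ?t'))
          = 2 * int (card p) + 2 * int (card {{m, f}}) - int (card (extra {x, y})) + 1}
      = (if ?\<gamma> \<in> p then {} else {(insert ?\<gamma> p, {})})" (is "?R = _")
  proof (rule Set.set_eqI, clarify)
    fix q z'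
    show "(q, z') \<in> ?R \<longleftrightarrow> (q, z') \<in> (if ?\<gamma> \<in> p then {} else {(insert ?\<gamma> p, {})})"
    proof
      assume "(q, z') \<in> ?R"
      then have q: "q \<subseteq> circles D s" "\<forall>\<gamma>\<in>circles D s. \<gamma> \<noteq> ?\<gamma> \<longrightarrow> (\<gamma> \<in> p \<longleftrightarrow> \<gamma> \<in> q)"
        "z' = {}" "card q = Suc (card p)" by (auto simp: ex)
      then show "(q, z') \<in> (if ?\<gamma> \<in> p then {} else {(insert ?\<gamma> p, {})})"
        using agree_off_circle(2)[OF p q(1,2)] by simp
    next
      assume "(q, z') \<in> (if ?\<gamma> \<in> p then {} else {(insert ?\<gamma> p, {})})"
      then have q: "?\<gamma> \<notin> p" "q = insert ?\<gamma> p" "z' = {}" by (auto split: if_splits)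
      have q': "q \<subseteq> circles D s" "\<forall>\<gamma>\<in>circles D s. \<gamma> \<noteq> ?\<gamma> \<longrightarrow> (\<gamma> \<in> p \<longleftrightarrow> \<gamma> \<in> q)"
        using p \<gamma> by (auto simp: q(2))
      then have "card q = Suc (card p)" using agree_off_circle(2)[OF p q'] q by simp
      then show "(q, z') \<in> ?R" using q' q(3) by (simp add: ex)
    qed
  qed
  show ?thesis
    unfolding boundary_at_def place_def fst_conv snd_conv st
      transitions_clasp_image[OF s order_refl w p z] count
    by simp
qed

text \<open>
  Merging a negative extra circle is multiplication by the unit.
\<close>

lemma boundary_at_merge_negative:
  assumes S: "(s, p) \<in> enhanced_states D" and w: "w \<in> {x, y}"
  shows "boundary_at D' (place {x, y} {} (s, p)) w = frag_of (place ({x, y} - {w}) {} (s, p))"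
proof -
  have s: "s \<subseteq> crossings D" and p: "p \<subseteq> circles D s" using S by (auto simp: enhanced_states_def)
  let ?\<gamma> = "circle_through D s e" and ?t' = "{x, y} - {w}"
  have "w \<notin> s" using s w xy by blast
  then have st: "(s \<union> {x, y}) - {w} = s \<union> ?t'" by (rule Un_remove)
  have ex: "extra ?t' = {}" using w xy(1) by (auto simp: extra_def)
  have z: "{} \<subseteq> extra {x, y}" by simp
  have count: "{(q, z'). q \<subseteq> circles D s \<and> z' \<subseteq> extra ?t' \<and>
        (\<forall>\<gamma>\<in>circles D s. \<gamma> \<noteq> ?\<gamma> \<longrightarrow> (\<gamma> \<in> p \<longleftrightarrow> \<gamma> \<in> q)) \<and>
        2 * int (card q) + 2 * int (card z') - int (card (extra ?t'))
          = 2 * int (card p) + 2 * int (card ({} :: 'e set set)) - int (card (extra {x, y})) + 1}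
      = {(p, {})}" (is "?R = _")
  proof (rule Set.set_eqI, clarify)
    fix q z'
    show "(q, z') \<in> ?R \<longleftrightarrow> (q, z') \<in> {(p, {})}"
    proof
      assume "(q, z') \<in> ?R"
      then have q: "q \<subseteq> circles D s" "\<forall>\<gamma>\<in>circles D s. \<gamma> \<noteq> ?\<gamma> \<longrightarrow> (\<gamma> \<in> p \<longleftrightarrow> \<gamma> \<in> q)"
        "z' = {}" "card q = card p" by (auto simp: ex)
      then show "(q, z') \<in> {(p, {})}" using agree_off_circle(1)[OF p q(1,2)] by simp
    next
      assume "(q, z') \<in> {(p, {})}"
      then show "(q, z') \<in> ?R" using p by (simp add: ex)
    qed
  qed
  show ?thesis
    unfolding boundary_at_def place_def fst_conv snd_conv st
      transitions_clasp_image[OF s order_refl w p z] count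
    by simp
qed

text \<open>
  Splitting off the extra circle is the comultiplication, \<open>a \<mapsto> a \<otimes> X + X a \<otimes> 1\<close>.
\<close>

lemma boundary_at_split:
  assumes S: "(s, p) \<in> enhanced_states D" and w: "w \<in> {x, y}"
  shows "boundary_at D' (place {w} {} (s, p)) w
    = frag_of (place {} {{m, g}} (s, p))
      + (if circle_through D s e \<in> p then 0
         else frag_of (place {} {} (s, insert (circle_through D s e) p)))"
proof -
  have s: "s \<subseteq> crossings D" and p: "p \<subseteq> circles D s" using S by (auto simp: enhanced_states_def)
  let ?\<gamma> = "circle_through D s e"
  have \<gamma>: "?\<gamma> \<in> circles D s" using e by (rule circle_through_in_circles)
  have "w \<notin> s" using s w xy by blast
  then have st: "(s \<union> {w}) - {w} = s" "{w} - {w} = {}" by (simp_all add: Un_Diff)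
  have ex: "extra {w} = {}" using w xy(1) by auto
  have z: "{} \<subseteq> extra {w}" and t: "{w} \<subseteq> {x, y}" using w by simp_all
  let ?R = "{(q, z'). q \<subseteq> circles D s \<and> z' \<subseteq> extra ({w} - {w}) \<and>
        (\<forall>\<gamma>\<in>circles D s. \<gamma> \<noteq> ?\<gamma> \<longrightarrow> (\<gamma> \<in> p \<longleftrightarrow> \<gamma> \<in> q)) \<and>
        2 * int (card q) + 2 * int (card z') - int (card (extra ({w} - {w})))
          = 2 * int (card p) + 2 * int (card ({} :: 'e set set)) - int (card (extra {w})) + 1}"
  let ?Q = "insert (p, {{m, g}}) (if ?\<gamma> \<in> p then {} else {(insert ?\<gamma> p, {})})"
  have count: "?R = ?Q"
  proof (rule Set.set_eqI, clarify)
    fix q z'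
    show "(q, z') \<in> ?R \<longleftrightarrow> (q, z') \<in> ?Q"
    proof
      assume "(q, z') \<in> ?R"
      then have q: "q \<subseteq> circles D s" "\<forall>\<gamma>\<in>circles D s. \<gamma> \<noteq> ?\<gamma> \<longrightarrow> (\<gamma> \<in> p \<longleftrightarrow> \<gamma> \<in> q)"
        "z' \<subseteq> {{m, g}}" "2 * int (card q) + 2 * int (card z') - 1 = 2 * int (card p) + 1"
        by (auto simp: ex)
      from q(3) consider "z' = {}" | "z' = {{m, g}}" by (meson subset_singletonD)
      then show "(q, z') \<in> ?Q"
      proof cases
        case 1
        then have "card q = Suc (card p)" using q(4) by simp
        then show ?thesis using 1 agree_off_circle(2)[OF p q(1,2)] by simp
      next
        case 2
        then have "card q = card p" using q(4) by simp
        then show ?thesis using 2 agree_off_circle(1)[OF p q(1,2)] by simp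
      qed
    next
      assume "(q, z') \<in> ?Q"
      then consider "q = p" "z' = {{m, g}}" | "?\<gamma> \<notin> p" "q = insert ?\<gamma> p" "z' = {}"
        by (auto split: if_splits)
      then show "(q, z') \<in> ?R"
      proof cases
        case 1
        then show ?thesis using p by (simp add: ex)
      next
        case 2
        have q': "q \<subseteq> circles D s" "\<forall>\<gamma>\<in>circles D s. \<gamma> \<noteq> ?\<gamma> \<longrightarrow> (\<gamma> \<in> p \<longleftrightarrow> \<gamma> \<in> q)"
          using p \<gamma> by (auto simp: 2(2))
        then have "card q = Suc (card p)" using agree_off_circle(2)[OF p q'] 2 by simp
        then show ?thesis using q' 2(3) by (simp add: ex)
      qed
    qed
  qed
  have "insert ?\<gamma> p \<subseteq> circles D s" using p \<gamma> by simp
  have ne: "ext {} ` p \<union> {{m, g}} \<noteq> ext {} ` insert ?\<gamma> p \<union> {}"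
  proof
    assume "ext {} ` p \<union> {{m, g}} = ext {} ` insert ?\<gamma> p \<union> {}"
    then have "{{m, g}} = ({} :: 'e set set)"
      using placed_eq_iff[OF p \<open>insert ?\<gamma> p \<subseteq> circles D s\<close>, of "{{m, g}}" "{}" "{}"] by simp
    then show False by simp
  qed
  show ?thesis
    unfolding boundary_at_def place_def fst_conv snd_conv
      transitions_clasp_image[OF s t _ p z, of w, OF singletonI] count
    unfolding st
    using ne by simp
qed

end

section \<open>Splitting off two copies of the smaller complex\<close>

lemma boundary_add: "boundary D (a + b) = boundary D a + boundary D b"
  and boundary_diff: "boundary D (a - b) = boundary D a - boundary D b"
  and boundary_minus: "boundary D (- a) = - boundary D a"
  and boundary_0 [simp]: "boundary D 0 = 0"
  by (simp_all add: boundary_def frag_extend_add frag_extend_diff frag_extend_minus)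

lemma edge_action_diff: "edge_action D u (a - b) = edge_action D u a - edge_action D u b"
  and edge_action_add: "edge_action D u (a + b) = edge_action D u a + edge_action D u b"
  and edge_action_minus: "edge_action D u (- a) = - edge_action D u a"
  and edge_action_0 [simp]: "edge_action D u 0 = 0"
  by (simp_all add: edge_action_def frag_extend_add frag_extend_diff frag_extend_minus)

lemma keys_boundary:
  assumes wf: "well_formed D" and a: "Poly_Mapping.keys a \<subseteq> enhanced_states D"
  shows "Poly_Mapping.keys (boundary D a) \<subseteq> enhanced_states D"
proof -
  have "Poly_Mapping.keys (boundary D (frag_of S)) \<subseteq> enhanced_states D"
    if "S \<in> enhanced_states D" for S
  proof -
    have "frag_of S \<in> chains D (sigma D S) (sigma D S + 2 * tau D S)"
      using that by (simp add: generators_def)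
    from boundary_chains[OF this wf] show ?thesis by (auto simp: generators_def)
  qed
  then show ?thesis
    using a by (auto simp: boundary_def dest!: subsetD[OF keys_frag_extend])
qed

lemma keys_edge_action:
  assumes wf: "well_formed D" and u: "u \<in> edges D" and a: "Poly_Mapping.keys a \<subseteq> enhanced_states D"
  shows "Poly_Mapping.keys (edge_action D u a) \<subseteq> enhanced_states D"
proof -
  have "Poly_Mapping.keys (edge_action D u (frag_of S)) \<subseteq> enhanced_states D"
    if "S \<in> enhanced_states D" for S
  proof -
    have "frag_of S \<in> chains D (sigma D S) (sigma D S + 2 * tau D S)"
      using that by (simp add: generators_def)
    from edge_action_chains[OF wf u this] show ?thesis by (auto simp: generators_def)
  qed
  then show ?thesis
    using a by (auto simp: edge_action_def dest!: subsetD[OF keys_frag_extend])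
qed

context hopf_clasp
begin

lemma block_incl_add: "block_incl t z (a + b) = block_incl t z a + block_incl t z b"
  and block_incl_diff: "block_incl t z (a - b) = block_incl t z a - block_incl t z b"
  and block_incl_minus: "block_incl t z (- a) = - block_incl t z a"
  and block_incl_0 [simp]: "block_incl t z 0 = 0"
  by (simp_all add: block_incl_def frag_extend_add frag_extend_diff frag_extend_minus)

abbreviation act :: "(('c, 'e) enhanced_state \<Rightarrow>\<^sub>0 int) \<Rightarrow> (('c, 'e) enhanced_state \<Rightarrow>\<^sub>0 int)" where
  "act \<equiv> edge_action D e"

lemma block_incl_act_frag_of:
  "block_incl t z (act (frag_of (s, p)))
    = frag_cmul (twist t s) (if circle_through D s e \<in> p then 0
        else frag_of (place t z (s, insert (circle_through D s e) p)))"
  by (simp add: edge_action_def make_positive_def)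

lemma marker_sets [simp]:
  "{x, y} - {x} = {y}" "{x, y} - {y} = {x}" "x \<noteq> y" "y \<noteq> x"
  "{x, y} \<noteq> {x}" "{x, y} \<noteq> {y}" "{x} \<noteq> {x, y}" "{y} \<noteq> {x, y}"
  using xy(1) by auto

lemma parity_simps [simp]:
  "parity {x, y} = 1" "parity {x} = -1" "parity {y} = -1" "parity {} = 1"
  by (simp_all add: parity_def)

lemma boundary_merge_positive:
  assumes "Poly_Mapping.keys a \<subseteq> enhanced_states D"
  shows "boundary D' (block_incl {x, y} {{m, f}} a)
    = block_incl {x, y} {{m, f}} (boundary D a) + block_incl {y} {} (act a) + block_incl {x} {} (act a)"
  using assms
proof (induction a rule: frag_induction)
  case (one S)
  obtain s p where S: "S = (s, p)" by fastforce
  show ?case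
    using boundary_block_incl[of s p "{x, y}" "{{m, f}}"] one
      boundary_at_merge_positive[of s p x] boundary_at_merge_positive[of s p y]
    unfolding S block_incl_act_frag_of by (simp add: add.assoc)
qed (simp_all add: boundary_diff edge_action_diff block_incl_diff)

lemma boundary_merge_negative:
  assumes "Poly_Mapping.keys a \<subseteq> enhanced_states D"
  shows "boundary D' (block_incl {x, y} {} a)
    = block_incl {x, y} {} (boundary D a) + block_incl {y} {} a + block_incl {x} {} a"
  using assms
proof (induction a rule: frag_induction)
  case (one S)
  obtain s p where S: "S = (s, p)" by fastforce
  show ?case
    using boundary_block_incl[of s p "{x, y}" "{}"] one
      boundary_at_merge_negative[of s p x] boundary_at_merge_negative[of s p y]
    unfolding S by (simp add: add.assoc)
qed (simp_all add: boundary_diff block_incl_diff)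

lemma boundary_split_y:
  assumes "Poly_Mapping.keys a \<subseteq> enhanced_states D"
  shows "boundary D' (block_incl {y} {} a)
    = - block_incl {y} {} (boundary D a) + block_incl {} {{m, g}} a + block_incl {} {} (act a)"
  using assms
proof (induction a rule: frag_induction)
  case (one S)
  obtain s p where S: "S = (s, p)" by fastforce
  show ?case
    using boundary_block_incl[of s p "{y}" "{}"] one boundary_at_split[of s p y]
    unfolding S block_incl_act_frag_of by (simp add: add.assoc frag_cmul_distrib2)
qed (simp_all add: boundary_diff edge_action_diff block_incl_diff)

lemma boundary_split_x:
  assumes "Poly_Mapping.keys a \<subseteq> enhanced_states D"
  shows "boundary D' (block_incl {x} {} a)
    = - block_incl {x} {} (boundary D a) - block_incl {} {{m, g}} a - block_incl {} {} (act a)"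
  using assms
proof (induction a rule: frag_induction)
  case (one S)
  obtain s p where S: "S = (s, p)" by fastforce
  show ?case
    using boundary_block_incl[of s p "{x}" "{}"] one boundary_at_split[of s p x]
    unfolding S block_incl_act_frag_of
    by (simp add: diff_conv_add_uminus add.assoc frag_cmul_distrib2 del: add_uminus_conv_diff)
qed (simp_all add: boundary_diff edge_action_diff block_incl_diff)

lemma boundary_bottom:
  assumes "Poly_Mapping.keys a \<subseteq> enhanced_states D" and "z \<subseteq> {{m, g}}"
  shows "boundary D' (block_incl {} z a) = block_incl {} z (boundary D a)"
  using assms(1)
proof (induction a rule: frag_induction)
  case (one S)
  obtain s p where S: "S = (s, p)" by fastforce
  show ?case
    using boundary_block_incl[of s p "{}" z] one assms(2) unfolding S by simp
qed (simp_all add: boundary_diff block_incl_diff)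

lemma place_states:
  assumes S: "S \<in> enhanced_states D" and t: "t \<subseteq> {x, y}" and z: "z \<subseteq> extra t"
  shows "place t z S \<in> enhanced_states D'"
    and "sigma D' (place t z S) = sigma D S + 2 * int (card t) - 2"
    and "tau D' (place t z S) = tau D S + 2 * int (card z) - int (card (extra t))"
proof -
  obtain s p where Seq: "S = (s, p)" by fastforce
  have s: "s \<subseteq> crossings D" and p: "p \<subseteq> circles D s" using S by (auto simp: enhanced_states_def Seq)
  have st: "s \<union> t \<subseteq> crossings D'" using s t by (auto simp: crossings')
  show "place t z S \<in> enhanced_states D'"
    using placed_subset[OF s t p z] st by (simp add: enhanced_states_def place_def Seq)
  show "tau D' (place t z S) = tau D S + 2 * int (card z) - int (card (extra t))"
    using tau_placed[OF s t p z] by (simp add: place_def Seq)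
  have "s \<inter> t = {}" using s t xy by blast
  moreover have "finite s" "finite t" using s t fin finite_subset by (metis, metis finite.simps)
  ultimately have "card (s \<union> t) = card s + card t" by (simp add: card_Un_disjoint)
  moreover have "card (crossings D') = card (crossings D) + 2"
    using fin xy by (simp add: crossings')
  moreover have "finite (crossings D')" using fin by (simp add: crossings')
  ultimately show "sigma D' (place t z S) = sigma D S + 2 * int (card t) - 2"
    using s st fin by (simp add: sigma_eq place_def Seq)
qed

lemma place_eq_iff:
  assumes S: "S \<in> enhanced_states D" "t \<subseteq> {x, y}" "z \<subseteq> extra t"
    and S': "S' \<in> enhanced_states D" "t' \<subseteq> {x, y}" "z' \<subseteq> extra t'"
  shows "place t z S = place t' z' S' \<longleftrightarrow> t = t' \<and> z = z' \<and> S = S'"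
proof
  assume eq: "place t z S = place t' z' S'"
  obtain s p s' p' where Seq: "S = (s, p)" "S' = (s', p')" by fastforce
  have s: "s \<subseteq> crossings D" "p \<subseteq> circles D s" "s' \<subseteq> crossings D" "p' \<subseteq> circles D s'"
    using S S' by (auto simp: enhanced_states_def Seq)
  have st: "s \<union> t = s' \<union> t'" and pz: "ext t ` p \<union> z = ext t' ` p' \<union> z'"
    using eq by (simp_all add: place_def Seq)
  have ns: "x \<notin> s" "y \<notin> s" "x \<notin> s'" "y \<notin> s'" using s xy by blast+
  have "t = (s \<union> t) \<inter> {x, y}" "t' = (s' \<union> t') \<inter> {x, y}" using ns S(2) S'(2) by blast+
  then have t: "t = t'" using st by simp
  have "s = (s \<union> t) \<inter> crossings D" "s' = (s' \<union> t') \<inter> crossings D"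
    using s(1,3) S(2) S'(2) xy by blast+
  then have "s = s'" using st by simp
  then show "t = t' \<and> z = z' \<and> S = S'"
    using pz s S(3) S'(3) placed_eq_iff[of p s p' s' z t z'] by (simp add: t Seq)
qed simp

lemma place_exhaust:
  assumes "S' \<in> enhanced_states D'"
  obtains t z S where "t \<subseteq> {x, y}" "z \<subseteq> extra t" "S \<in> enhanced_states D" "S' = place t z S"
proof -
  obtain s' p' where S': "S' = (s', p')" by fastforce
  have s': "s' \<subseteq> crossings D'" "p' \<subseteq> circles D' s'" using assms by (auto simp: enhanced_states_def S')
  define s where "s = s' \<inter> crossings D"
  define t where "t = s' \<inter> {x, y}"
  have st: "s' = s \<union> t" using s'(1) by (auto simp: s_def t_def crossings')
  have s: "s \<subseteq> crossings D" and t: "t \<subseteq> {x, y}" by (auto simp: s_def t_def)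
  obtain q z where "p' = ext t ` q \<union> z" "q \<subseteq> circles D s" "z \<subseteq> extra t"
    using placed_exhaust[OF s t] s'(2) unfolding st by metis
  then show ?thesis
    using that[of t z "(s, q)"] s t by (simp add: S' st place_def enhanced_states_def)
qed

text \<open>
  The coordinate map of the block \<open>(t, z)\<close>. The sign \<open>twist\<close> is its own inverse, so the same factor
  appears here as in \<open>block_incl\<close>.
\<close>

definition block_proj ::
  "'c set \<Rightarrow> 'e set set \<Rightarrow> (('c, 'e) enhanced_state \<Rightarrow>\<^sub>0 int) \<Rightarrow> (('c, 'e) enhanced_state \<Rightarrow>\<^sub>0 int)"
  where "block_proj t z = frag_extend (\<lambda>S'. if S' \<in> place t z ` enhanced_states D
    then let S = inv_into (enhanced_states D) (place t z) S' in frag_cmul (twist t (fst S)) (frag_of S)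
    else 0)"

lemma block_proj_add: "block_proj t z (a + b) = block_proj t z a + block_proj t z b"
  and block_proj_diff: "block_proj t z (a - b) = block_proj t z a - block_proj t z b"
  and block_proj_minus: "block_proj t z (- a) = - block_proj t z a"
  and block_proj_0 [simp]: "block_proj t z 0 = 0"
  by (simp_all add: block_proj_def frag_extend_add frag_extend_diff frag_extend_minus)

lemma block_proj_place:
  assumes t: "t \<subseteq> {x, y}" and z: "z \<subseteq> extra t" and t': "t' \<subseteq> {x, y}" and z': "z' \<subseteq> extra t'"
    and S: "S \<in> enhanced_states D"
  shows "block_proj t z (frag_of (place t' z' S))
    = (if t = t' \<and> z = z' then frag_cmul (twist t (fst S)) (frag_of S) else 0)"
proof (cases "t = t' \<and> z = z'")
  case True
  have "inj_on (place t z) (enhanced_states D)"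
    by (rule inj_onI) (simp add: place_eq_iff t z)
  then show ?thesis using True S by (simp add: block_proj_def)
next
  case False
  then have "place t' z' S \<notin> place t z ` enhanced_states D"
    using place_eq_iff[OF _ t z S t' z'] by (metis imageE)
  then show ?thesis unfolding if_not_P[OF False] by (simp add: block_proj_def)
qed

lemma block_proj_incl:
  assumes t: "t \<subseteq> {x, y}" and z: "z \<subseteq> extra t" and t': "t' \<subseteq> {x, y}" and z': "z' \<subseteq> extra t'"
    and a: "Poly_Mapping.keys a \<subseteq> enhanced_states D"
  shows "block_proj t z (block_incl t' z' a) = (if t = t' \<and> z = z' then a else 0)"
  using a
proof (induction a rule: frag_induction)
  case (one S)
  have "block_proj t z (block_incl t' z' (frag_of S))
      = frag_cmul (twist t' (fst S)) (block_proj t z (frag_of (place t' z' S)))"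
    by (simp add: block_proj_def frag_extend_cmul)
  then show ?case
    by (simp add: block_proj_place[OF t z t' z' one] twist_square)
qed (auto simp: block_proj_diff block_incl_diff)

text \<open>
  An additive statement about \<open>C(D')\<close> need only be checked on the six blocks.
\<close>

lemma block_induct [consumes 1, case_names diff incl]:
  assumes a: "Poly_Mapping.keys a' \<subseteq> enhanced_states D'"
    and diff: "\<And>a b. P a \<Longrightarrow> P b \<Longrightarrow> P (a - b)"
    and incl: "\<And>t z a. t \<subseteq> {x, y} \<Longrightarrow> z \<subseteq> extra t \<Longrightarrow> Poly_Mapping.keys a \<subseteq> enhanced_states D \<Longrightarrow>
       P (block_incl t z a)"
  shows "P a'"
  using a
proof (induction a' rule: frag_induction)
  case zero
  show ?case using incl[of "{}" "{}" 0] by simp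
next
  case (one S')
  obtain t z S where S: "t \<subseteq> {x, y}" "z \<subseteq> extra t" "S \<in> enhanced_states D" "S' = place t z S"
    using place_exhaust[OF one] .
  have "frag_of S' = block_incl t z (frag_cmul (twist t (fst S)) (frag_of S))"
    by (simp add: block_incl_def frag_extend_cmul S(4) twist_square)
  moreover have "Poly_Mapping.keys (frag_cmul (twist t (fst S)) (frag_of S)) \<subseteq> enhanced_states D"
    using S(3) by (auto dest: subsetD[OF keys_cmul])
  ultimately show ?case using incl[OF S(1,2)] by simp
next
  case (diff a b)
  then show ?case using assms(2) by blast
qed

lemma extra_cases:
  assumes "t \<subseteq> {x, y}" "z \<subseteq> extra t"
  obtains "t = {x, y}" "z = {{m, f}}" | "t = {x, y}" "z = {}" | "t = {x}" "z = {}"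
    | "t = {y}" "z = {}" | "t = {}" "z = {{m, g}}" | "t = {}" "z = {}"
  using assms(1)
proof (cases rule: clasp_cases)
  case 1
  then have "z = {} \<or> z = {{m, f}}" using assms(2) by (simp add: subset_singleton_iff)
  then show ?thesis using 1 that by blast
next
  case 4
  then have "z = {} \<or> z = {{m, g}}" using assms(2) by (simp add: subset_singleton_iff)
  then show ?thesis using 4 that by blast
qed (use assms(2) that in simp_all)

lemma block_incl_chains:
  assumes t: "t \<subseteq> {x, y}" and z: "z \<subseteq> extra t" and a: "a \<in> chains D i j"
    and "i' = i + 2 * int (card t) - 2"
    and "j' = j + 2 * int (card t) - 2 + 2 * (2 * int (card z) - int (card (extra t)))"
  shows "block_incl t z a \<in> chains D' i' j'"
proof -
  have "place t z S \<in> generators D' i' j'" if "S \<in> generators D i j" for S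
    using that place_states[of S t z] t z assms(4,5) by (auto simp: generators_def)
  then show ?thesis
    using a keys_frag_extend[of "\<lambda>S. frag_cmul (twist t (fst S)) (frag_of (place t z S))" a]
    by (fastforce simp: block_incl_def dest!: subsetD[OF keys_cmul])
qed

lemma block_proj_chains:
  assumes t: "t \<subseteq> {x, y}" and z: "z \<subseteq> extra t" and a: "a \<in> chains D' i' j'"
    and "i' = i + 2 * int (card t) - 2"
    and "j' = j + 2 * int (card t) - 2 + 2 * (2 * int (card z) - int (card (extra t)))"
  shows "block_proj t z a \<in> chains D i j"
proof -
  have "Poly_Mapping.keys (block_proj t z (frag_of S')) \<subseteq> generators D i j"
    if "S' \<in> generators D' i' j'" for S'
  proof (cases "S' \<in> place t z ` enhanced_states D")
    case True
    then obtain S where S: "S \<in> enhanced_states D" "S' = place t z S" by blast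
    then have "S \<in> generators D i j"
      using that place_states[of S t z] t z assms(4,5) by (auto simp: generators_def)
    then show ?thesis
      using block_proj_place[OF t z t z S(1)] by (auto simp: S(2) dest: subsetD[OF keys_cmul])
  qed (simp add: block_proj_def)
  then show ?thesis
    using a by (auto simp: block_proj_def dest!: subsetD[OF keys_frag_extend])
qed

end

lemma chains_states: "a \<in> chains D i j \<Longrightarrow> Poly_Mapping.keys a \<subseteq> enhanced_states D"
  by (auto simp: generators_def)

lemma chains_diff: "a \<in> chains D i j \<Longrightarrow> b \<in> chains D i j \<Longrightarrow> a - b \<in> chains D i j"
  using keys_diff[of a b] by auto

lemma chains_add: "a \<in> chains D i j \<Longrightarrow> b \<in> chains D i j \<Longrightarrow> a + b \<in> chains D i j"
  using keys_add[of a b] by auto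

context hopf_clasp
begin

text \<open>
  With coordinates \<open>a\<^sub>+\<close>, \<open>a\<^sub>-\<close> on the block of two positive markers (extra circle positive, negative),
  \<open>b\<close> and \<open>c\<close> on the blocks \<open>{y}\<close> and \<open>{x}\<close>, and \<open>u\<^sub>+\<close>, \<open>u\<^sub>-\<close> on the block of two negative markers, the
  differential of \<open>C(D')\<close> has the components

  \<open>\<partial>a\<^sub>+\<close>, \<open>\<partial>a\<^sub>-\<close>, \<open>X a\<^sub>+ + a\<^sub>- - \<partial>b\<close>, \<open>X a\<^sub>+ + a\<^sub>- - \<partial>c\<close>, \<open>b - c + \<partial>u\<^sub>+\<close>, \<open>X b - X c + \<partial>u\<^sub>-\<close>.

  The kernel of multiplication is embedded by \<open>a \<mapsto> (a, - X a)\<close> and has the retraction \<open>a\<^sub>+\<close>. The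
  cokernel of comultiplication is represented by \<open>u\<^sub>-\<close> and has the retraction \<open>u\<^sub>- - X u\<^sub>+\<close>, which is the
  combination of \<open>u\<^sub>+\<close> and \<open>u\<^sub>-\<close> that vanishes on the image of comultiplication. The homotopy undoes the unit
  components of the differential: it sends \<open>b\<close> back to \<open>a\<^sub>-\<close> and \<open>u\<^sub>+\<close> back to \<open>- c\<close>.
\<close>

definition incl_top where
  "incl_top a = block_incl {x, y} {{m, f}} a - block_incl {x, y} {} (act a)"

definition incl_bot where
  "incl_bot a = block_incl {} {} a"

definition retr_top where
  "retr_top a' = block_proj {x, y} {{m, f}} a'"

definition retr_bot where
  "retr_bot a' = block_proj {} {} a' - act (block_proj {} {{m, g}} a')"

definition homotopy where
  "homotopy a' = block_incl {x, y} {} (block_proj {y} {} a') - block_incl {x} {} (block_proj {} {{m, g}} a')"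

lemma additive_maps:
  "additive incl_top" "additive incl_bot" "additive retr_top" "additive retr_bot" "additive homotopy"
  by (simp_all add: additive_def incl_top_def incl_bot_def retr_top_def retr_bot_def homotopy_def
      block_incl_add block_proj_add edge_action_add)

lemmas maps_diff = additive_maps[THEN additive.diff]

lemma keys_act:
  "Poly_Mapping.keys a \<subseteq> enhanced_states D \<Longrightarrow> Poly_Mapping.keys (act a) \<subseteq> enhanced_states D"
  by (rule keys_edge_action[OF wf e])

lemmas boundary_blocks = boundary_merge_positive boundary_merge_negative boundary_split_x
  boundary_split_y boundary_bottom

lemma boundary_incl:
  assumes "Poly_Mapping.keys a \<subseteq> enhanced_states D"
  shows "boundary D' (incl_top a) = incl_top (boundary D a)"
    and "boundary D' (incl_bot a) = incl_bot (boundary D a)"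
  using assms keys_act[OF assms] edge_action_boundary[OF wf e assms]
  by (simp_all add: incl_top_def incl_bot_def boundary_diff boundary_blocks)

lemma retr_incl:
  assumes "Poly_Mapping.keys a \<subseteq> enhanced_states D"
  shows "retr_top (incl_top a) = a" "retr_bot (incl_bot a) = a"
    "retr_bot (incl_top a) = 0" "retr_top (incl_bot a) = 0"
  using assms keys_act[OF assms]
  by (simp_all add: incl_top_def incl_bot_def retr_top_def retr_bot_def block_proj_diff block_proj_incl)

lemma boundary_retr:
  assumes "Poly_Mapping.keys a' \<subseteq> enhanced_states D'"
  shows "retr_top (boundary D' a') = boundary D (retr_top a')
    \<and> retr_bot (boundary D' a') = boundary D (retr_bot a')"
  using assms
proof (induction a' rule: block_induct)
  case (diff a b)
  then show ?case by (simp add: boundary_diff maps_diff)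
next
  case (incl t z a)
  note k = incl(3) keys_boundary[OF wf incl(3)] keys_act[OF incl(3)]
    keys_act[OF keys_boundary[OF wf incl(3)]]
  note comm = edge_action_boundary[OF wf e incl(3)]
  from incl(1,2) show ?case
    by (cases rule: extra_cases)
      (use k comm in \<open>simp_all add: retr_top_def retr_bot_def boundary_blocks block_proj_add
        block_proj_diff block_proj_minus block_proj_incl boundary_diff edge_action_diff edge_action_add
        boundary_minus edge_action_minus\<close>)
qed

lemma homotopy_formula:
  assumes "Poly_Mapping.keys a' \<subseteq> enhanced_states D'"
  shows "a' = incl_top (retr_top a') + incl_bot (retr_bot a')
    + boundary D' (homotopy a') + homotopy (boundary D' a')"
  using assms
proof (induction a' rule: block_induct)
  case (diff a b)
  have "a - b = (incl_top (retr_top a) + incl_bot (retr_bot a)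
      + boundary D' (homotopy a) + homotopy (boundary D' a))
    - (incl_top (retr_top b) + incl_bot (retr_bot b)
      + boundary D' (homotopy b) + homotopy (boundary D' b))"
    using diff by (rule arg_cong2)
  also have "\<dots> = incl_top (retr_top (a - b)) + incl_bot (retr_bot (a - b))
      + boundary D' (homotopy (a - b)) + homotopy (boundary D' (a - b))"
    by (simp add: boundary_diff maps_diff)
  finally show ?case .
next
  case (incl t z a)
  note k = incl(3) keys_boundary[OF wf incl(3)] keys_act[OF incl(3)]
    keys_act[OF keys_boundary[OF wf incl(3)]]
  note comm = edge_action_boundary[OF wf e incl(3)]
  from incl(1,2) show ?case
    by (cases rule: extra_cases)
      (use k comm in \<open>simp_all add: retr_top_def retr_bot_def incl_top_def incl_bot_def
        homotopy_def boundary_blocks block_proj_add block_incl_add block_incl_minus block_incl_diff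
        block_proj_diff block_proj_minus block_proj_incl boundary_diff edge_action_diff edge_action_add
        boundary_minus edge_action_minus\<close>)
qed

lemma boundary_boundary':
  assumes sq: "\<And>a. Poly_Mapping.keys a \<subseteq> enhanced_states D \<Longrightarrow> boundary D (boundary D a) = 0"
    and "Poly_Mapping.keys a' \<subseteq> enhanced_states D'"
  shows "boundary D' (boundary D' a') = 0"
  using assms(2)
proof (induction a' rule: block_induct)
  case (diff a b)
  then show ?case by (simp add: boundary_diff)
next
  case (incl t z a)
  note k = incl(3) keys_boundary[OF wf incl(3)] keys_act[OF incl(3)]
    keys_act[OF keys_boundary[OF wf incl(3)]]
  note comm = edge_action_boundary[OF wf e incl(3)]
  from incl(1,2) show ?case
    by (cases rule: extra_cases)
      (use k comm sq[OF k(1)] in \<open>simp_all add: boundary_blocks boundary_add boundary_diff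
        boundary_minus edge_action_minus\<close>)
qed

lemma incl_chains:
  assumes "a \<in> chains D i j"
  shows "incl_top a \<in> chains D' (i + 2) (j + 4)" "incl_bot a \<in> chains D' (i - 2) (j - 4)"
proof -
  have "act a \<in> chains D i (j + 4)" using edge_action_chains[OF wf e assms] .
  then have "block_incl {x, y} {} (act a) \<in> chains D' (i + 2) (j + 4)"
    by (rule block_incl_chains[rotated 2]) simp_all
  moreover have "block_incl {x, y} {{m, f}} a \<in> chains D' (i + 2) (j + 4)"
    by (rule block_incl_chains[OF _ _ assms]) simp_all
  ultimately show "incl_top a \<in> chains D' (i + 2) (j + 4)"
    unfolding incl_top_def by (rule chains_diff[rotated])
  show "incl_bot a \<in> chains D' (i - 2) (j - 4)"
    unfolding incl_bot_def by (rule block_incl_chains[OF _ _ assms]) simp_all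
qed

lemma retr_chains:
  assumes "a' \<in> chains D' i j"
  shows "retr_top a' \<in> chains D (i - 2) (j - 4)" "retr_bot a' \<in> chains D (i + 2) (j + 4)"
proof -
  show "retr_top a' \<in> chains D (i - 2) (j - 4)"
    unfolding retr_top_def by (rule block_proj_chains[OF _ _ assms]) simp_all
  have "block_proj {} {{m, g}} a' \<in> chains D (i + 2) j"
    by (rule block_proj_chains[OF _ _ assms]) simp_all
  then have "act (block_proj {} {{m, g}} a') \<in> chains D (i + 2) (j + 4)"
    by (rule edge_action_chains[OF wf e])
  moreover have "block_proj {} {} a' \<in> chains D (i + 2) (j + 4)"
    by (rule block_proj_chains[OF _ _ assms]) simp_all
  ultimately show "retr_bot a' \<in> chains D (i + 2) (j + 4)"
    unfolding retr_bot_def by (rule chains_diff[rotated])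
qed

lemma homotopy_chains:
  assumes "a' \<in> chains D' i j"
  shows "homotopy a' \<in> chains D' (i + 2) j"
proof -
  have "block_proj {y} {} a' \<in> chains D i j"
    by (rule block_proj_chains[OF _ _ assms]) simp_all
  then have "block_incl {x, y} {} (block_proj {y} {} a') \<in> chains D' (i + 2) j"
    by (rule block_incl_chains[rotated 2]) simp_all
  moreover have "block_proj {} {{m, g}} a' \<in> chains D (i + 2) j"
    by (rule block_proj_chains[OF _ _ assms]) simp_all
  then have "block_incl {x} {} (block_proj {} {{m, g}} a') \<in> chains D' (i + 2) j"
    by (rule block_incl_chains[rotated 2]) simp_all
  ultimately show ?thesis unfolding homotopy_def by (rule chains_diff)
qed

end

section \<open>Contraction to a complex with zero differential\<close>

text \<open>
  A deformation retraction of the Khovanov complex onto the free group on \<open>B\<close>, taken with zero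
  differential and graded by \<open>deg\<close>. That the square of the differential is zero is included, since it is
  established along the same induction and a quotient by boundaries needs it.
\<close>

definition contraction ::
  "('c::linorder, 'e) diagram \<Rightarrow> 'b set \<Rightarrow> ('b \<Rightarrow> int \<times> int) \<Rightarrow>
     (('b \<Rightarrow>\<^sub>0 int) \<Rightarrow> (('c, 'e) enhanced_state \<Rightarrow>\<^sub>0 int)) \<Rightarrow>
     ((('c, 'e) enhanced_state \<Rightarrow>\<^sub>0 int) \<Rightarrow> ('b \<Rightarrow>\<^sub>0 int)) \<Rightarrow>
     ((('c, 'e) enhanced_state \<Rightarrow>\<^sub>0 int) \<Rightarrow> (('c, 'e) enhanced_state \<Rightarrow>\<^sub>0 int)) \<Rightarrow> bool" where
  "contraction D B deg \<iota> r h \<longleftrightarrow>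
     additive \<iota> \<and> additive r \<and> additive h \<and>
     (\<forall>b\<in>B. \<iota> (frag_of b) \<in> chains D (fst (deg b)) (snd (deg b)) \<and>
        boundary D (\<iota> (frag_of b)) = 0 \<and> r (\<iota> (frag_of b)) = frag_of b) \<and>
     (\<forall>i j. \<forall>a\<in>chains D i j. Poly_Mapping.keys (r a) \<subseteq> {b \<in> B. deg b = (i, j)} \<and>
        h a \<in> chains D (i + 2) j \<and> r (boundary D a) = 0 \<and>
        a = \<iota> (r a) + boundary D (h a) + h (boundary D a) \<and>
        boundary D (boundary D a) = 0)"

lemma contractionD:
  assumes "contraction D B deg \<iota> r h"
  shows "additive \<iota>" "additive r" "additive h"
    and "b \<in> B \<Longrightarrow> \<iota> (frag_of b) \<in> chains D (fst (deg b)) (snd (deg b))"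
    and "b \<in> B \<Longrightarrow> boundary D (\<iota> (frag_of b)) = 0"
    and "b \<in> B \<Longrightarrow> r (\<iota> (frag_of b)) = frag_of b"
    and "a \<in> chains D i j \<Longrightarrow> Poly_Mapping.keys (r a) \<subseteq> {b \<in> B. deg b = (i, j)}"
    and "a \<in> chains D i j \<Longrightarrow> h a \<in> chains D (i + 2) j"
    and "a \<in> chains D i j \<Longrightarrow> r (boundary D a) = 0"
    and "a \<in> chains D i j \<Longrightarrow> a = \<iota> (r a) + boundary D (h a) + h (boundary D a)"
    and "a \<in> chains D i j \<Longrightarrow> boundary D (boundary D a) = 0"
  using assms unfolding contraction_def by blast+

lemma frag_extend_additive:
  assumes "additive \<phi>"
  shows "frag_extend (\<lambda>b. \<phi> (frag_of b)) v = \<phi> v"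
proof -
  have "Poly_Mapping.keys v \<subseteq> UNIV" by simp
  then show ?thesis
    by (induction v rule: frag_induction)
      (simp_all add: additive.zero[OF assms] additive.diff[OF assms] frag_extend_diff)
qed

text \<open>
  A generator of the homology records the sign of the trivial knot one starts with, in the last entry,
  and which of the two copies is chosen in each step.
\<close>

fun hopf_degree :: "bool list \<Rightarrow> int \<times> int" where
  "hopf_degree [] = (0, 0)"
| "hopf_degree [b] = (0, if b then 2 else -2)"
| "hopf_degree (b # l) = hopf_degree l + (if b then (2, 4) else (-2, -4))"

lemma hopf_degree_Cons:
  "l \<noteq> [] \<Longrightarrow> hopf_degree (b # l) = hopf_degree l + (if b then (2, 4) else (-2, -4))"
  by (cases l) simp_all

text \<open>
  The contraction of \<open>C(D')\<close> onto two copies of \<open>C(D)\<close> is followed by the given one in each copy.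
\<close>

lemma (in hopf_clasp) contraction_step:
  assumes contr: "contraction D {l :: bool list. length l = Suc n} hopf_degree \<iota> r h"
  shows "\<exists>\<iota> r h. contraction D' {l :: bool list. length l = Suc (Suc n)} hopf_degree \<iota> r h"
proof -
  let ?B = "{l :: bool list. length l = Suc n}" and ?B' = "{l :: bool list. length l = Suc (Suc n)}"
  note lin = contractionD(1-3)[OF contr] and basis = contractionD(4-6)[OF contr]
  define cons :: "bool \<Rightarrow> (bool list \<Rightarrow>\<^sub>0 int) \<Rightarrow> (bool list \<Rightarrow>\<^sub>0 int)"
    where "cons c = frag_extend (frag_of \<circ> (#) c)" for c
  define \<iota>' where "\<iota>' = frag_extend (\<lambda>l. if hd l then incl_top (\<iota> (frag_of (tl l)))
      else incl_bot (\<iota> (frag_of (tl l))))"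
  define r' where "r' a = cons True (r (retr_top a)) + cons False (r (retr_bot a))" for a
  define h' where "h' a = homotopy a + (incl_top (h (retr_top a)) + incl_bot (h (retr_bot a)))" for a
  note adds = additive_maps[THEN additive.add] lin[THEN additive.add]
  have lin': "additive \<iota>'" "additive r'" "additive h'"
    by (simp_all add: additive_def \<iota>'_def r'_def h'_def cons_def frag_extend_add adds)
  have \<iota>'_cons: "\<iota>' (cons True v) = incl_top (\<iota> v)" "\<iota>' (cons False v) = incl_bot (\<iota> v)" for v
  proof -
    have ext: "additive (\<lambda>v. incl_top (\<iota> v))" "additive (\<lambda>v. incl_bot (\<iota> v))"
      by (simp_all add: additive_def adds)
    show "\<iota>' (cons True v) = incl_top (\<iota> v)" "\<iota>' (cons False v) = incl_bot (\<iota> v)"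
      unfolding \<iota>'_def cons_def frag_extend_compose
      by (simp_all add: comp_def ext[THEN frag_extend_additive])
  qed
  have cons_0: "cons c 0 = 0" for c by (simp add: cons_def)
  have keys_cons: "Poly_Mapping.keys (cons c v) \<subseteq> (#) c ` Poly_Mapping.keys v" for c v
    using keys_frag_extend[of "frag_of \<circ> (#) c" v] by (auto simp: cons_def)
  have zeros: "incl_top 0 = 0" "incl_bot 0 = 0" "r 0 = 0" "homotopy 0 = 0" "h 0 = 0"
    using additive_maps lin by (auto intro: additive.zero)
  have sq: "boundary D (boundary D a) = 0" if "Poly_Mapping.keys a \<subseteq> enhanced_states D" for a
    using that
  proof (induction a rule: frag_induction)
    case (one S)
    then have "frag_of S \<in> chains D (sigma D S) (sigma D S + 2 * tau D S)"
      by (simp add: generators_def)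
    then show ?case by (rule contractionD(11)[OF contr])
  qed (simp_all add: boundary_diff)
  have "\<iota>' (frag_of l) \<in> chains D' (fst (hopf_degree l)) (snd (hopf_degree l)) \<and>
        boundary D' (\<iota>' (frag_of l)) = 0 \<and> r' (\<iota>' (frag_of l)) = frag_of l" if mem: "l \<in> ?B'" for l
  proof -
    obtain c l' where l: "l = c # l'" "l' \<in> ?B" using mem by (cases l) auto
    then have "l' \<noteq> []" by auto
    note deg = hopf_degree_Cons[OF this, of True] hopf_degree_Cons[OF this, of False]
    note b = basis[OF l(2)]
    note st = chains_states[OF b(1)]
    have cons_of: "cons c (frag_of l') = frag_of l" by (simp add: cons_def l)
    show ?thesis
    proof (cases c)
      case True
      have "\<iota>' (frag_of l) = incl_top (\<iota> (frag_of l'))" by (simp add: \<iota>'_def l True)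
      then show ?thesis
        using incl_chains(1)[OF b(1)] boundary_incl(1)[OF st] b(2,3) retr_incl[OF st] cons_of
        by (simp add: deg l True r'_def zeros cons_0)
    next
      case False
      have "\<iota>' (frag_of l) = incl_bot (\<iota> (frag_of l'))" by (simp add: \<iota>'_def l False)
      then show ?thesis
        using incl_chains(2)[OF b(1)] boundary_incl(2)[OF st] b(2,3) retr_incl[OF st] cons_of
        by (simp add: deg l False r'_def zeros cons_0)
    qed
  qed
  moreover have "Poly_Mapping.keys (r' a) \<subseteq> {b \<in> ?B'. hopf_degree b = (i, j)} \<and>
        h' a \<in> chains D' (i + 2) j \<and> r' (boundary D' a) = 0 \<and>
        a = \<iota>' (r' a) + boundary D' (h' a) + h' (boundary D' a) \<and> boundary D' (boundary D' a) = 0"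
    if a: "a \<in> chains D' i j" for i j a
  proof (intro conjI)
    note st = chains_states[OF a]
    note top = contractionD(7-10)[OF contr retr_chains(1)[OF a]]
      and bot = contractionD(7-10)[OF contr retr_chains(2)[OF a]]
    note retr = boundary_retr[OF st, THEN conjunct1] boundary_retr[OF st, THEN conjunct2]
    show "boundary D' (boundary D' a) = 0" by (rule boundary_boundary'[OF sq st])
    show "r' (boundary D' a) = 0" using top(3) bot(3) by (simp add: r'_def retr cons_0)
    note hd = top(2) bot(2)
    show "h' a \<in> chains D' (i + 2) j"
    proof -
      have "incl_top (h (retr_top a)) \<in> chains D' (i + 2) j"
        "incl_bot (h (retr_bot a)) \<in> chains D' (i + 2) j"
        using incl_chains(1)[OF hd(1)] incl_chains(2)[OF hd(2)] by (simp_all add: add.commute)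
      then show ?thesis
        unfolding h'_def by (intro chains_add homotopy_chains[OF a])
    qed
    show "Poly_Mapping.keys (r' a) \<subseteq> {b \<in> ?B'. hopf_degree b = (i, j)}"
    proof
      fix l assume "l \<in> Poly_Mapping.keys (r' a)"
      then have "l \<in> Poly_Mapping.keys (cons True (r (retr_top a)))
          \<union> Poly_Mapping.keys (cons False (r (retr_bot a)))"
        unfolding r'_def by (rule subsetD[OF keys_add])
      then have "l \<in> (#) True ` Poly_Mapping.keys (r (retr_top a))
          \<or> l \<in> (#) False ` Poly_Mapping.keys (r (retr_bot a))"
        using subsetD[OF keys_cons[of True "r (retr_top a)"]]
          subsetD[OF keys_cons[of False "r (retr_bot a)"]] by (elim UnE) simp_all
      then show "l \<in> {b \<in> ?B'. hopf_degree b = (i, j)}"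
      proof (elim disjE imageE)
        fix l' assume l: "l = True # l'" and "l' \<in> Poly_Mapping.keys (r (retr_top a))"
        from this(2) have l': "length l' = Suc n" "hopf_degree l' = (i - 2, j - 4)"
          using subsetD[OF top(1)] by simp_all
        then have "l' \<noteq> []" by auto
        then show ?thesis using hopf_degree_Cons[of l' True] l' by (simp add: l)
      next
        fix l' assume l: "l = False # l'" and "l' \<in> Poly_Mapping.keys (r (retr_bot a))"
        from this(2) have l': "length l' = Suc n" "hopf_degree l' = (i + 2, j + 4)"
          using subsetD[OF bot(1)] by simp_all
        then have "l' \<noteq> []" by auto
        then show ?thesis using hopf_degree_Cons[of l' False] l' by (simp add: l)
      qed
    qed
    have "incl_top (retr_top a) = incl_top (\<iota> (r (retr_top a)))
        + boundary D' (incl_top (h (retr_top a))) + incl_top (h (retr_top (boundary D' a)))"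
    proof -
      have "incl_top (retr_top a) = incl_top (\<iota> (r (retr_top a)))
          + incl_top (boundary D (h (retr_top a))) + incl_top (h (boundary D (retr_top a)))"
        using arg_cong[OF top(4), of incl_top] by (simp only: additive.add[OF additive_maps(1)])
      then show ?thesis by (simp add: boundary_incl(1)[OF chains_states[OF hd(1)]] retr)
    qed
    moreover have "incl_bot (retr_bot a) = incl_bot (\<iota> (r (retr_bot a)))
        + boundary D' (incl_bot (h (retr_bot a))) + incl_bot (h (retr_bot (boundary D' a)))"
    proof -
      have "incl_bot (retr_bot a) = incl_bot (\<iota> (r (retr_bot a)))
          + incl_bot (boundary D (h (retr_bot a))) + incl_bot (h (boundary D (retr_bot a)))"
        using arg_cong[OF bot(4), of incl_bot] by (simp only: additive.add[OF additive_maps(2)])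
      then show ?thesis by (simp add: boundary_incl(2)[OF chains_states[OF hd(2)]] retr)
    qed
    ultimately have "incl_top (retr_top a) + incl_bot (retr_bot a)
        + boundary D' (homotopy a) + homotopy (boundary D' a)
      = \<iota>' (r' a) + boundary D' (h' a) + h' (boundary D' a)"
      by (simp add: r'_def h'_def additive.add[OF lin'(1)] \<iota>'_cons boundary_add)
    then show "a = \<iota>' (r' a) + boundary D' (h' a) + h' (boundary D' a)"
      by (rule trans[OF homotopy_formula[OF st]])
  qed
  ultimately have "contraction D' ?B' hopf_degree \<iota>' r' h'"
    unfolding contraction_def using lin' by blast
  then show ?thesis by blast
qed

section \<open>Homology from a contraction\<close>

lemma group_hom_differential:
  assumes wf: "well_formed D"
  shows "group_hom (chain_group D i j) (chain_group D (i - 2) j) (differential D i j)"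
proof -
  have "differential D i j \<in> hom (chain_group D i j) (chain_group D (i - 2) j)"
  proof (rule homI)
    fix a b assume a: "a \<in> chains D i j"
    then show "differential D i j a \<in> chains D (i - 2) j"
      using boundary_chains[OF a wf] differential_eq_boundary[OF a wf] by simp
    show "differential D i j (a \<otimes>\<^bsub>chain_group D i j\<^esub> b)
        = differential D i j a \<otimes>\<^bsub>chain_group D (i - 2) j\<^esub> differential D i j b"
      by (simp add: chain_group_def differential_def frag_extend_add)
  qed
  then show ?thesis
    unfolding group_hom_def group_hom_axioms_def by (simp add: chain_group_def)
qed

lemma carrier_cycle_group:
  assumes wf: "well_formed D"
  shows "carrier (cycle_group D i j) = {a \<in> chains D i j. boundary D a = 0}"
proof -
  have "differential D i j a = boundary D a" if "a \<in> chains D i j" for a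
    by (rule differential_eq_boundary[OF that wf])
  then have "{a \<in> chains D i j. differential D i j a = 0} = {a \<in> chains D i j. boundary D a = 0}"
    by (intro Collect_cong) metis
  then show ?thesis by (simp add: cycle_group_def kernel_def chain_group_def)
qed

lemma group_cycle_group:
  assumes wf: "well_formed D"
  shows "group (cycle_group D i j)"
  unfolding cycle_group_def
  using group_hom.subgroup_kernel[OF group_hom_differential[OF wf]]
  by (rule subgroup.subgroup_is_group) (simp add: chain_group_def)

text \<open>
  On cycles \<open>a = \<iota> (r a) + \<partial>(h a)\<close>, so the cycles in the kernel of \<open>r\<close> are exactly the boundaries, and \<open>r\<close> is onto
  because \<open>\<iota>\<close> lifts every element to a cycle. The claim is then the first isomorphism theorem.
\<close>

lemma homology_iso:
  assumes wf: "well_formed D" and contr: "contraction D B deg \<iota> r h"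
  shows "khovanov_homology D i j \<cong> free_Abelian_group {b \<in> B. deg b = (i, j)}"
    and "group (khovanov_homology D i j)"
proof -
  let ?Z = "cycle_group D i j" and ?F = "free_Abelian_group {b \<in> B. deg b = (i, j)}"
  note lin = contractionD(1-3)[OF contr] and basis = contractionD(4-6)[OF contr]
    and c = contractionD(7-11)[OF contr]
  note Z = carrier_cycle_group[OF wf, of i j]
  have mult: "a \<otimes>\<^bsub>?Z\<^esub> b = a + b" for a b by (simp add: cycle_group_def chain_group_def)
  have "r \<in> hom ?Z ?F"
  proof (rule homI)
    fix a b assume "a \<in> carrier ?Z"
    then have "a \<in> chains D i j" by (simp add: Z)
    then show "r a \<in> carrier ?F" using c(1) by simp
    show "r (a \<otimes>\<^bsub>?Z\<^esub> b) = r a \<otimes>\<^bsub>?F\<^esub> r b" by (simp add: mult additive.add[OF lin(2)])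
  qed
  then interpret r: group_hom ?Z ?F r
    unfolding group_hom_def group_hom_axioms_def using group_cycle_group[OF wf] by simp
  have lift: "\<iota> v \<in> chains D i j \<and> boundary D (\<iota> v) = 0 \<and> r (\<iota> v) = v"
    if "Poly_Mapping.keys v \<subseteq> {b \<in> B. deg b = (i, j)}" for v
    using that
  proof (induction v rule: frag_induction)
    case zero
    then show ?case using lin by (simp add: additive.zero)
  next
    case (one b)
    then show ?case using basis[of b] by simp
  next
    case (diff a b)
    then show ?case
      using lin chains_diff[of "\<iota> a" D i j "\<iota> b"] by (simp add: additive.diff boundary_diff)
  qed
  have "r ` carrier ?Z = carrier ?F"
  proof
    show "r ` carrier ?Z \<subseteq> carrier ?F" by (rule image_subsetI) (rule r.hom_closed)
    show "carrier ?F \<subseteq> r ` carrier ?Z"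
    proof
      fix v assume "v \<in> carrier ?F"
      then have v: "\<iota> v \<in> chains D i j" "boundary D (\<iota> v) = 0" "r (\<iota> v) = v"
        using lift by simp_all
      then have "\<iota> v \<in> carrier ?Z" by (simp add: Z)
      then show "v \<in> r ` carrier ?Z" using v(3) by (rule rev_image_eqI[OF _ sym])
    qed
  qed
  then have iso: "?Z Mod kernel ?Z ?F r \<cong> ?F" by (rule r.FactGroup_iso)
  have "kernel ?Z ?F r = differential D (i + 2) j ` chains D (i + 2) j"
  proof
    show "kernel ?Z ?F r \<subseteq> differential D (i + 2) j ` chains D (i + 2) j"
    proof
      fix a assume "a \<in> kernel ?Z ?F r"
      then have a: "a \<in> chains D i j" "boundary D a = 0" "r a = 0"
        by (simp_all add: kernel_def Z)
      have "a = \<iota> (r a) + boundary D (h a) + h (boundary D a)" by (rule c(4)[OF a(1)])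
      also have "\<dots> = boundary D (h a)" using lin by (simp add: a(2,3) additive.zero)
      also have "\<dots> = differential D (i + 2) j (h a)"
        by (rule differential_eq_boundary[OF c(2)[OF a(1)] wf, symmetric])
      finally show "a \<in> differential D (i + 2) j ` chains D (i + 2) j"
        using c(2)[OF a(1)] by (rule image_eqI)
    qed
    show "differential D (i + 2) j ` chains D (i + 2) j \<subseteq> kernel ?Z ?F r"
    proof (rule image_subsetI)
      fix a assume a: "a \<in> chains D (i + 2) j"
      have "boundary D a \<in> chains D i j" using boundary_chains[OF a wf] by simp
      then show "differential D (i + 2) j a \<in> kernel ?Z ?F r"
        unfolding differential_eq_boundary[OF a wf]
        using c(3,5)[OF a] by (simp add: kernel_def Z)
    qed
  qed
  then have eq: "khovanov_homology D i j = ?Z Mod kernel ?Z ?F r"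
    by (simp add: khovanov_homology_def)
  show "khovanov_homology D i j \<cong> ?F" unfolding eq by (rule iso)
  show "group (khovanov_homology D i j)"
    unfolding eq by (rule normal.factorgroup_is_group[OF r.normal_kernel])
qed

lemma free_rank_eq:
  assumes G: "group G" and iso: "G \<cong> free_Abelian_group B" and fin: "finite B"
  shows "free_rank G = card B"
proof -
  have "G \<cong> free_Abelian_group {..<r} \<longleftrightarrow> r = card B" for r
  proof -
    have "G \<cong> free_Abelian_group {..<r} \<longleftrightarrow> free_Abelian_group B \<cong> free_Abelian_group {..<r}"
      using iso group.iso_sym[OF G iso] by (meson iso_trans)
    also have "\<dots> \<longleftrightarrow> r = card B"
      using fin by (auto simp: isomorphic_free_Abelian_groups eqpoll_iff_card)
    finally show ?thesis .
  qed
  then show ?thesis by (simp add: free_rank_def)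
qed

text \<open>
  A basis is wanted in the type of cosets of chains. Any \<open>card B\<close> elements of that type will do; the
  singletons of multiples of one generator are used.
\<close>

lemma free_abelian_chain_cosets:
  fixes G :: "('a \<Rightarrow>\<^sub>0 int) set monoid"
  assumes iso: "G \<cong> free_Abelian_group B" and fin: "finite B"
  shows "free_abelian G"
proof -
  let ?f = "\<lambda>k. {frag_cmul (int k) (frag_of (undefined :: 'a))}"
  have "inj_on ?f {..<card B}"
  proof (rule inj_onI)
    fix k l assume "?f k = ?f l"
    then have "frag_cmul (int k) (frag_of (undefined :: 'a)) = frag_cmul (int l) (frag_of undefined)"
      by simp
    then have "Poly_Mapping.lookup (frag_cmul (int k) (frag_of (undefined :: 'a))) undefined
        = Poly_Mapping.lookup (frag_cmul (int l) (frag_of (undefined :: 'a))) undefined" by simp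
    then show "k = l" by simp
  qed
  then have "card (?f ` {..<card B}) = card B" by (simp add: card_image)
  then have "B \<approx> ?f ` {..<card B}" using fin by (simp add: eqpoll_iff_card)
  then have "G \<cong> free_Abelian_group (?f ` {..<card B})"
    using iso isomorphic_free_Abelian_groups iso_trans by blast
  then show ?thesis unfolding free_abelian_def by blast
qed

lemma khovanov_polynomial_eq:
  assumes wf: "well_formed D" and contr: "contraction D B deg \<iota> r h" and fin: "finite B"
  shows "khovanov_polynomial D = (\<Sum>b\<in>B. mono_ba (fst (deg b)) (snd (deg b)))"
proof -
  have rank: "free_rank (khovanov_homology D i j) = card {b \<in> B. deg b = (i, j)}" for i j
    using homology_iso[OF wf contr, of i j] fin by (simp add: free_rank_eq)
  let ?g = "\<lambda>d. of_nat (card {b \<in> B. deg b = d}) * mono_ba (fst d) (snd d)"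
  have "khovanov_polynomial D = Sum_any ?g"
    unfolding khovanov_polynomial_def rank by (simp add: case_prod_unfold)
  also have "\<dots> = sum ?g (deg ` B)"
  proof (rule Sum_any.expand_superset)
    show "{d. ?g d \<noteq> 0} \<subseteq> deg ` B"
    proof
      fix d assume "d \<in> {d. ?g d \<noteq> 0}"
      then have "card {b \<in> B. deg b = d} \<noteq> 0" by (auto intro: ccontr)
      then have "{b \<in> B. deg b = d} \<noteq> {}" by (metis card.empty)
      then show "d \<in> deg ` B" by blast
    qed
  qed (simp add: fin)
  also have "\<dots> = (\<Sum>d\<in>deg ` B. \<Sum>b\<in>{b \<in> B. deg b = d}. mono_ba (fst (deg b)) (snd (deg b)))"
    by (rule sum.cong[OF refl]) simp
  also have "\<dots> = (\<Sum>b\<in>B. mono_ba (fst (deg b)) (snd (deg b)))"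
    by (rule sum.image_gen[OF fin, symmetric])
  finally show ?thesis .
qed

section \<open>Connected sums of Hopf links\<close>

text \<open>
  There are two generators, one for each sign of the only circle, and no crossing to change.
\<close>

lemma trivial_knot_contraction:
  fixes D :: "('c::linorder, 'e) diagram"
  assumes "trivial_knot D"
  shows "well_formed D"
    and "\<exists>\<iota> r h. contraction D {l :: bool list. length l = Suc 0} hopf_degree \<iota> r h"
proof -
  obtain e where D: "crossings D = {}" "edges D = {e}" using assms by (auto simp: trivial_knot_def)
  show wf: "well_formed D" by (simp add: well_formed_def D)
  have circ: "circles D {} = {{e}}"
    by (auto simp: circles_eq D circle_through_def)
  define pos where "pos b = (if b then {{e}} else {})" for b
  have state: "fst S = {} \<and> frag_of S = frag_of ({}, pos (snd S \<noteq> {})) \<and>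
      hopf_degree [snd S \<noteq> {}] = (sigma D S, sigma D S + 2 * tau D S)"
    if "S \<in> enhanced_states D" for S
  proof -
    obtain s p where S: "S = (s, p)" by fastforce
    have s: "s = {}" using that by (simp add: S enhanced_states_def D)
    then have "p = {} \<or> p = {{e}}"
      using that by (simp add: S enhanced_states_def circ subset_singleton_iff)
    then show ?thesis
      by (elim disjE) (simp_all add: S s pos_def sigma_def tau_def D circ)
  qed
  have pos_state: "({}, pos b) \<in> enhanced_states D" for b
    by (simp add: enhanced_states_def circ pos_def)
  have pos_iff: "pos b \<noteq> {} \<longleftrightarrow> b" for b by (simp add: pos_def)
  have bd: "boundary D a = 0" if "Poly_Mapping.keys a \<subseteq> enhanced_states D" for a
    unfolding boundary_def
  proof (rule frag_extend_eq_0)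
    fix S assume "S \<in> Poly_Mapping.keys a"
    then have "fst S = {}" using that state by blast
    then show "(\<Sum>c\<in>fst S. frag_cmul ((-1) ^ negatives_above D (fst S) c) (boundary_at D S c)) = 0"
      by simp
  qed
  define \<iota> where "\<iota> = frag_extend (\<lambda>l. frag_of ({} :: 'c set, pos (hd l)))"
  define r where "r = frag_extend (\<lambda>S :: ('c, 'e) enhanced_state. frag_of [snd S \<noteq> {}])"
  define h where "h = (\<lambda>a :: ('c, 'e) enhanced_state \<Rightarrow>\<^sub>0 int. 0 :: ('c, 'e) enhanced_state \<Rightarrow>\<^sub>0 int)"
  have "contraction D {l :: bool list. length l = Suc 0} hopf_degree \<iota> r h"
    unfolding contraction_def
  proof (intro conjI ballI allI)
    show "additive \<iota>" "additive r" "additive h"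
      by (simp_all add: additive_def \<iota>_def r_def h_def frag_extend_add)
    fix l :: "bool list" assume "l \<in> {l. length l = Suc 0}"
    then obtain b where l: "l = [b]" by (auto simp: length_Suc_conv)
    have \<iota>l: "\<iota> (frag_of l) = frag_of ({}, pos b)" by (simp add: \<iota>_def l)
    show "\<iota> (frag_of l) \<in> chains D (fst (hopf_degree l)) (snd (hopf_degree l))"
      unfolding \<iota>l using state[OF pos_state, of b] pos_state[of b]
      by (simp add: l pos_iff generators_def)
    show "boundary D (\<iota> (frag_of l)) = 0"
      by (rule bd) (simp add: \<iota>l pos_state)
    show "r (\<iota> (frag_of l)) = frag_of l" unfolding \<iota>l by (simp add: r_def pos_iff l)
  next
    fix i j a assume a: "a \<in> chains D i j"
    note st = chains_states[OF a]
    show "Poly_Mapping.keys (r a) \<subseteq> {l \<in> {l. length l = Suc 0}. hopf_degree l = (i, j)}"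
      unfolding r_def
    proof (rule order_trans[OF keys_frag_extend], rule UN_least)
      fix S assume "S \<in> Poly_Mapping.keys a"
      then have S: "S \<in> generators D i j" using a by auto
      then have "hopf_degree [snd S \<noteq> {}] = (i, j)"
        using state[of S] by (simp add: generators_def)
      then show "Poly_Mapping.keys (frag_of [snd S \<noteq> {}])
          \<subseteq> {l \<in> {l. length l = Suc 0}. hopf_degree l = (i, j)}" by simp
    qed
    show "h a \<in> chains D (i + 2) j" by (simp add: h_def)
    show "r (boundary D a) = 0" by (simp add: bd[OF st] r_def)
    show "boundary D (boundary D a) = 0" by (simp add: bd[OF st])
    have "\<iota> (r a) = a"
      using st
    proof (induction a rule: frag_induction)
      case (one S)
      have "\<iota> (r (frag_of S)) = frag_of ({}, pos (snd S \<noteq> {}))" by (simp add: \<iota>_def r_def)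
      then show ?case using state[OF one] by simp
    qed (simp_all add: \<iota>_def r_def frag_extend_diff)
    then show "a = \<iota> (r a) + boundary D (h a) + h (boundary D a)" by (simp add: h_def)
  qed
  then show "\<exists>\<iota> r h. contraction D {l :: bool list. length l = Suc 0} hopf_degree \<iota> r h" by blast
qed

lemma connect_hopf_clasp:
  assumes "connect_hopf D D'" and wf: "well_formed D"
  shows "\<exists>e e' m f g x y. hopf_clasp D D' e e' m f g x y"
  using assms(1)
proof cases
  case (on_loop e x y m f g)
  have old: "c \<noteq> x \<and> c \<noteq> y" if "c \<in> crossings D" for c using on_loop that by auto
  have "hopf_clasp D D' e e m f g x y"
  proof
    fix c assume c: "c \<in> crossings D"
    then have "set (ends D c) \<subseteq> edges D" using wf by (simp add: well_formed_def)
    moreover have "ends D' c = ends D c" using old[OF c] on_loop(1) by simp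
    ultimately show "map (\<lambda>v. if v \<in> edges D then v else e) (ends D' c) = ends D c"
      "set (ends D' c) \<subseteq> edges D \<union> {e}"
      by (auto intro!: map_idI)
  qed (use on_loop wf in auto)
  then show ?thesis by blast
next
  case (on_arc e c k x y e' m f g)
  have old: "c' \<noteq> x \<and> c' \<noteq> y" if "c' \<in> crossings D" for c' using on_arc that by auto
  have len: "length (ends D c) = 4" using on_arc wf by (simp add: well_formed_def)
  have "hopf_clasp D D' e e' m f g x y"
  proof
    fix c' assume c': "c' \<in> crossings D"
    then have sub: "set (ends D c') \<subseteq> edges D" using wf by (simp add: well_formed_def)
    let ?F = "\<lambda>v. if v \<in> edges D then v else e"
    have id: "map ?F (ends D c') = ends D c'" by (rule map_idI) (use sub in auto)
    have ends: "ends D' c' = (if c' = c then (ends D c)[k := e'] else ends D c')"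
      using old[OF c'] on_arc(1) by simp
    have "e' \<notin> edges D" using on_arc by auto
    then have "map ?F ((ends D c)[k := e']) = (map ?F (ends D c))[k := e]"
      by (simp add: map_update)
    then have "map ?F ((ends D c)[k := e']) = ends D c" if "c' = c"
      using id that on_arc(5) by (metis list_update_id)
    then show "map ?F (ends D' c') = ends D c'" using id by (simp add: ends)
    show "set (ends D' c') \<subseteq> edges D \<union> {e'}"
      using sub set_update_subset_insert[of "ends D c" k e'] by (auto simp: ends)
  qed (use on_arc wf in auto)
  then show ?thesis by blast
qed

lemma hopf_sum_contraction:
  assumes "trivial_knot U" "(connect_hopf ^^ n) U D"
  shows "well_formed D \<and>
    (\<exists>\<iota> r h. contraction D {l :: bool list. length l = Suc n} hopf_degree \<iota> r h)"
  using assms(2)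
proof (induction n arbitrary: D)
  case 0
  then show ?case using trivial_knot_contraction[OF assms(1)] by simp
next
  case (Suc n)
  then obtain D0 where D0: "(connect_hopf ^^ n) U D0" "connect_hopf D0 D" by auto
  from Suc.IH[OF D0(1)] obtain \<iota> r h where wf: "well_formed D0"
    and contr: "contraction D0 {l :: bool list. length l = Suc n} hopf_degree \<iota> r h" by blast
  obtain e e' m f g x y where "hopf_clasp D0 D e e' m f g x y"
    using connect_hopf_clasp[OF D0(2) wf] by blast
  then interpret hopf_clasp D0 D e e' m f g x y .
  show ?case using well_formed' contraction_step[OF contr] by blast
qed

lemma mono_ba_mult: "mono_ba i j * mono_ba k l = mono_ba (i + k) (j + l)"
  by (simp add: mono_ba_def mult_single)

lemma hopf_degree_polynomial:
  "(\<Sum>l | length l = Suc n. mono_ba (fst (hopf_degree l)) (snd (hopf_degree l)))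
    = (mono_ba 0 2 + mono_ba 0 (-2)) * (mono_ba 2 4 + mono_ba (-2) (-4)) ^ n"
proof (induction n)
  case 0
  have "{l :: bool list. length l = Suc 0} = {[True], [False]}"
    by (auto simp: length_Suc_conv)
  then show ?case by simp
next
  case (Suc n)
  let ?L = "\<lambda>n. {l :: bool list. length l = Suc n}"
  let ?w = "\<lambda>l. mono_ba (fst (hopf_degree l)) (snd (hopf_degree l))"
  have fin: "finite (?L n)" using finite_lists_length_eq[of "UNIV :: bool set" "Suc n"] by simp
  have split: "?L (Suc n) = (#) True ` ?L n \<union> (#) False ` ?L n"
  proof (rule Set.set_eqI)
    fix l :: "bool list"
    show "l \<in> ?L (Suc n) \<longleftrightarrow> l \<in> (#) True ` ?L n \<union> (#) False ` ?L n"
      by (cases l) auto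
  qed
  have w: "?w (True # l) = ?w l * mono_ba 2 4" "?w (False # l) = ?w l * mono_ba (-2) (-4)"
    if "l \<in> ?L n" for l
  proof -
    have "l \<noteq> []" using that by auto
    then show "?w (True # l) = ?w l * mono_ba 2 4" "?w (False # l) = ?w l * mono_ba (-2) (-4)"
      by (simp_all add: hopf_degree_Cons mono_ba_mult)
  qed
  have "sum ?w (?L (Suc n)) = sum ?w ((#) True ` ?L n) + sum ?w ((#) False ` ?L n)"
    unfolding split by (rule sum.union_disjoint) (use fin in auto)
  also have "\<dots> = (\<Sum>l\<in>?L n. ?w (True # l)) + (\<Sum>l\<in>?L n. ?w (False # l))"
    by (simp add: sum.reindex)
  also have "\<dots> = (\<Sum>l\<in>?L n. ?w l * mono_ba 2 4) + (\<Sum>l\<in>?L n. ?w l * mono_ba (-2) (-4))"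
    by (intro arg_cong2[of _ _ _ _ "(+)"] sum.cong refl w)
  also have "\<dots> = sum ?w (?L n) * (mono_ba 2 4 + mono_ba (-2) (-4))"
    by (simp add: sum_distrib_right distrib_left)
  finally show ?case using Suc by (simp add: mult.assoc mult.commute)
qed

theorem corollary6p6:
  fixes D :: "('c::linorder, 'e) diagram" and n :: nat
  assumes "n \<ge> 1" and "hopf_connected_sum n D"
  shows "(\<forall>i j. free_abelian (khovanov_homology D i j)) \<and>
         khovanov_polynomial D =
           (mono_ba 0 2 + mono_ba 0 (-2)) * (mono_ba 2 4 + mono_ba (-2) (-4)) ^ n"
proof -
  obtain U :: "('c, 'e) diagram" where "trivial_knot U" "(connect_hopf ^^ n) U D"
    using assms(2) by (auto simp: hopf_connected_sum_def)
  then obtain \<iota> r h where wf: "well_formed D"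
    and contr: "contraction D {l :: bool list. length l = Suc n} hopf_degree \<iota> r h"
    using hopf_sum_contraction by blast
  have fin: "finite {l :: bool list. length l = Suc n}"
    using finite_lists_length_eq[of "UNIV :: bool set" "Suc n"] by simp
  have "free_abelian (khovanov_homology D i j)" for i j
  proof (rule free_abelian_chain_cosets[OF homology_iso(1)[OF wf contr]])
    show "finite {b \<in> {l. length l = Suc n}. hopf_degree b = (i, j)}"
      using fin by (rule rev_finite_subset) auto
  qed
  then show ?thesis
    using khovanov_polynomial_eq[OF wf contr fin] hopf_degree_polynomial[of n] by simp
qed

end
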